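(* Let $n\in\mathbb{N}_0=\{0,1,2,\dots\}$, $\nu\in\mathbb{R}$ and $\beta\in[0,1)$. The following statements hold. (a) If $\nu>n$, then $r_\beta^\ast(f_{\nu,n})=x_{\nu,1}^{(n)}$, where $x_{\nu,1}^{(n)}$ is the smallest positive root of the equation $$\frac{rJ_\nu^{(n+1)}(r)}{(\nu-n)J_\nu^{(n)}(r)}-\beta=0.$$ Moreover, if $n-1<\nu<n$, then $r_\beta^\ast(f_{\nu,n})=x_{\nu,2}^{(n)}$, where $x_{\nu,2}^{(n)}$ is the smallest positive root of the equation $$\frac{rI_\nu^{(n+1)}(r)}{(\nu-n)I_\nu^{(n)}(r)}-\beta=0.$$ (b) If $\nu>n-1$, then $r_\beta^\ast(g_{\nu,n})=y_{\nu,1}^{(n)}$, where $y_{\nu,1}^{(n)}$ is the smallest positive root of the equation $$\frac{rJ_\nu^{(n+1)}(r)}{J_\nu^{(n)}(r)}+n+1-\nu-\beta=0.$$ (c) If $\nu>n-1$, then $r_\beta^\ast(h_{\nu,n})=z_{\nu,1}^{(n)}$, where $z_{\nu,1}^{(n)}$ is the smallest positive root of the equation $$\frac{\sqrt r\,J_\nu^{(n+1)}(\sqrt r)}{J_\nu^{(n)}(\sqrt r)}+n+2-\nu-2\beta=0.$$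
   Context: $J_\nu(z)=\sum_{m\ge 0}\frac{(-1)^m}{m!\,\Gamma(m+\nu+1)}\left(\frac z2\right)^{2m+\nu}$ is the Bessel function of the first kind of order $\nu$, $J_\nu^{(n)}$ is its $n$th derivative, and $I_\nu(z)=i^{-\nu}J_\nu(iz)=\sum_{m\ge 0}\frac{1}{m!\,\Gamma(m+\nu+1)}\left(\frac z2\right)^{2m+\nu}$ is the modified Bessel function of the first kind, with $n$th derivative $I_\nu^{(n)}$. For $\nu>n-1$ (and $\nu\neq n$ for $f_{\nu,n}$) define the normalized functions $$f_{\nu,n}(z)=\left[2^\nu\Gamma(\nu-n+1)J_\nu^{(n)}(z)\right]^{\frac1{\nu-n}},\quad g_{\nu,n}(z)=2^\nu\Gamma(\nu-n+1)z^{1+n-\nu}J_\nu^{(n)}(z),\quad h_{\nu,n}(z)=2^\nu\Gamma(\nu-n+1)z^{1+\frac{n-\nu}2}J_\nu^{(n)}(\sqrt z).$$ Each is understood as the analytic function near $0$ with value $0$ and derivative $1$ at $0$: one has $$2^\nu\Gamma(\nu-n+1)z^{n-\nu}J_\nu^{(n)}(z)=\sum_{m\ge0}\frac{(-1)^m\Gamma(2m+\nu+1)\Gamma(\nu-n+1)}{m!\,4^m\,\Gamma(2m-n+\nu+1)\Gamma(m+\nu+1)}z^{2m}=:E(z),$$ an even entire function with $E(0)=1$, and $g_{\nu,n}(z)=zE(z)$, $h_{\nu,n}(z)=zE(\sqrt z)$ (both entire), $f_{\nu,n}(z)=zE(z)^{1/(\nu-n)}$ with the branch equal to $1$ at $z=0$.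 For $f$ analytic near $0$ with $f(0)=0$, $f'(0)=1$, and with $r_f$ the radius of convergence of its power series at $0$, the radius of starlikeness of order $\beta\in[0,1)$ is $$r_\beta^\ast(f)=\sup\left\{r\in(0,r_f):\ \mathrm{Re}\left(\frac{zf'(z)}{f(z)}\right)>\beta\ \text{for all } z\in\mathbb{D}_r\right\},\qquad \mathbb{D}_r=\{z\in\mathbb{C}:|z|<r\},$$ where $zf'(z)/f(z)$ takes the value $1$ at $z=0$. *)

theory Defs
  imports "HOL-Complex_Analysis.Complex_Analysis"
begin

section \<open>Bessel functions\<close>

text \<open>
  Principal power with real exponent, except that \<open>z^0 = 1\<close> also at \<open>z = 0\<close>
  (HOL has \<open>0 powr 0 = 0\<close>, which would make \<open>J\<^sub>0\<close> and \<open>I\<^sub>0\<close> vanish at the origin).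
\<close>
definition rpow :: "complex \<Rightarrow> real \<Rightarrow> complex" where
  "rpow z a = (if a = 0 then 1 else z powr of_real a)"

text \<open>
  Where \<open>Gamma\<close> has a pole, HOL gives it the value 0, and then \<open>1 / 0 = 0\<close>, as it should be.
\<close>
definition Bessel_J :: "real \<Rightarrow> complex \<Rightarrow> complex" where
  "Bessel_J \<nu> z = (\<Sum>m. of_real ((-1) ^ m / (fact m * Gamma (real m + \<nu> + 1)))
                        * rpow (z / 2) (2 * real m + \<nu>))"

definition Bessel_I :: "real \<Rightarrow> complex \<Rightarrow> complex" where
  "Bessel_I \<nu> z = (\<Sum>m. of_real (1 / (fact m * Gamma (real m + \<nu> + 1)))
                        * rpow (z / 2) (2 * real m + \<nu>))"


section \<open>The normalized functions\<close>

text \<open>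
  The even entire function \<open>E\<close> with
  \<open>E(z) = 2^\<nu> \<Gamma>(\<nu>-n+1) z^(n-\<nu>) J\<^sub>\<nu>^(n)(z)\<close>; off the cut of the principal power this
  identity is proved below as \<open>higher_deriv_Bessel_J\<close>.
\<close>
definition Bessel_E :: "real \<Rightarrow> nat \<Rightarrow> complex \<Rightarrow> complex" where
  "Bessel_E \<nu> n z = (\<Sum>m. of_real (((-1) ^ m * Gamma (2 * real m + \<nu> + 1) * Gamma (\<nu> - real n + 1))
        / (fact m * 4 ^ m * Gamma (2 * real m - real n + \<nu> + 1) * Gamma (real m + \<nu> + 1)))
      * z ^ (2 * m))"

text \<open>
  Near 0 the principal power below is the branch of \<open>E(z)^(1/(\<nu>-n))\<close> that equals 1 at 0. Farther
  out \<open>E\<close> may cross the cut; \<open>starlikeness_radius\<close> therefore uses only the germ of \<open>Bessel_f\<close> at 0.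
\<close>
definition Bessel_f :: "real \<Rightarrow> nat \<Rightarrow> complex \<Rightarrow> complex" where
  "Bessel_f \<nu> n z = z * Bessel_E \<nu> n z powr of_real (1 / (\<nu> - real n))"

definition Bessel_g :: "real \<Rightarrow> nat \<Rightarrow> complex \<Rightarrow> complex" where
  "Bessel_g \<nu> n z = z * Bessel_E \<nu> n z"

text \<open>The choice of the square root is irrelevant because \<open>E\<close> is even.\<close>
definition Bessel_h :: "real \<Rightarrow> nat \<Rightarrow> complex \<Rightarrow> complex" where
  "Bessel_h \<nu> n z = z * Bessel_E \<nu> n (csqrt z)"


section \<open>Radius of starlikeness and smallest positive roots\<close>

text \<open>
  On its disc of convergence, \<open>f\<close> is the sum \<open>F\<close> of its power series at 0. A zero of \<open>F\<close> other
  than the origin is a pole of \<open>z F'(z) / F(z)\<close> and violates the condition. At the origin the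
  quotient has the value 1, which exceeds \<open>\<beta>\<close>. The supremum is taken in \<open>ereal\<close> as it may be infinite.
\<close>
definition starlikeness_radius :: "real \<Rightarrow> (complex \<Rightarrow> complex) \<Rightarrow> ereal" where
  "starlikeness_radius \<beta> f = (let F = eval_fps (fps_expansion f 0) in
     Sup {ereal r | r. 0 < r \<and> ereal r < fps_conv_radius (fps_expansion f 0) \<and>
       (\<forall>z\<in>ball 0 r. z \<noteq> 0 \<longrightarrow> F z \<noteq> 0 \<and> Re (z * deriv F z / F z) > \<beta>)})"

definition smallest_positive_root :: "(real \<Rightarrow> bool) \<Rightarrow> real \<Rightarrow> bool" where
  "smallest_positive_root P x \<longleftrightarrow> 0 < x \<and> P x \<and> (\<forall>r. 0 < r \<and> P r \<longrightarrow> x \<le> r)"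


section \<open>The normalized functions in terms of the derivatives of \<open>J\<^sub>\<nu>\<close>\<close>

definition Bessel_fps :: "real \<Rightarrow> nat \<Rightarrow> complex fps" where
  "Bessel_fps \<nu> n = Abs_fps (\<lambda>m. of_real ((-1) ^ m * Gamma (2 * real m + \<nu> + 1)
      * rGamma (2 * real m - real n + \<nu> + 1) * rGamma (real m + \<nu> + 1) / (fact m * 4 ^ m)))"

lemma Bessel_fps_0_nth:
  assumes "\<nu> > -1"
  shows "fps_nth (Bessel_fps \<nu> 0) m
           = of_real ((-1) ^ m * rGamma (real m + \<nu> + 1) / (fact m * 4 ^ m))"
proof -
  have "Gamma (2 * real m + \<nu> + 1) > 0"
    using assms by (intro Gamma_real_pos) auto
  thus ?thesis
    by (simp add: Bessel_fps_def rGamma_inverse_Gamma)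
qed

lemma Bessel_fps_Suc:
  "Bessel_fps \<nu> (Suc n) = fps_const (of_real (\<nu> - real n)) * Bessel_fps \<nu> n
      + fps_const 2 * (fps_X * fps_deriv (Bessel_fps \<nu> n))"
proof (rule fps_ext)
  fix m :: nat
  have rG: "rGamma (2 * real m - real (Suc n) + \<nu> + 1)
      = (2 * real m - real n + \<nu>) * rGamma (2 * real m - real n + \<nu> + 1)"
    using rGamma_plus1[of "2 * real m - real n + \<nu>"] by (simp add: algebra_simps)
  have "fps_nth (Bessel_fps \<nu> (Suc n)) m
      = of_real (2 * real m - real n + \<nu>) * fps_nth (Bessel_fps \<nu> n) m"
    unfolding Bessel_fps_def fps_nth_Abs_fps rG by simp
  thus "fps_nth (Bessel_fps \<nu> (Suc n)) m
      = fps_nth (fps_const (of_real (\<nu> - real n)) * Bessel_fps \<nu> n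
          + fps_const 2 * (fps_X * fps_deriv (Bessel_fps \<nu> n))) m"
    by (cases m) (simp_all add: algebra_simps)
qed

lemma fps_conv_radius_Bessel_fps [simp]:
  assumes "\<nu> > -1"
  shows "fps_conv_radius (Bessel_fps \<nu> n) = \<infinity>"
proof (induction n)
  case 0
  define b where "b = (\<lambda>m. fps_nth (Bessel_fps \<nu> 0) m)"
  have nz: "b m \<noteq> 0" for m
  proof -
    have "Gamma (real m + \<nu> + 1) > 0"
      using assms by (intro Gamma_real_pos) auto
    hence "Gamma (real m + \<nu> + 1) \<noteq> 0"
      by simp
    thus ?thesis
      using assms by (simp add: b_def Bessel_fps_0_nth rGamma_inverse_Gamma)
  qed
  have ratio: "norm (b m) / norm (b (Suc m)) = 4 * (real m + 1) * (real m + \<nu> + 1)" for m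
  proof -
    have G: "Gamma (real m + \<nu> + 1) > 0"
      using assms by (intro Gamma_real_pos) auto
    have G': "Gamma (real m + \<nu> + 2) = (real m + \<nu> + 1) * Gamma (real m + \<nu> + 1)"
    proof -
      have "real m + \<nu> + 1 \<notin> \<int>\<^sub>\<le>\<^sub>0"
        using assms by (intro notI) (auto dest: nonpos_Ints_nonpos)
      from Gamma_plus1[OF this] show ?thesis
        by (simp add: add_ac)
    qed
    have "norm (b m) = 1 / (Gamma (real m + \<nu> + 1) * (fact m * 4 ^ m))"
      using assms G unfolding b_def Bessel_fps_0_nth[OF assms] norm_of_real
      by (simp add: rGamma_inverse_Gamma abs_mult power_abs field_simps)
    moreover have "norm (b (Suc m))
        = 1 / ((real m + \<nu> + 1) * Gamma (real m + \<nu> + 1) * (fact (Suc m) * 4 ^ Suc m))"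
    proof -
      have "rGamma (real (Suc m) + \<nu> + 1)
          = inverse ((real m + \<nu> + 1) * Gamma (real m + \<nu> + 1))"
        using G' by (simp add: rGamma_inverse_Gamma add_ac)
      moreover have "\<bar>real m + \<nu> + 1\<bar> = real m + \<nu> + 1"
          "\<bar>Gamma (real m + \<nu> + 1)\<bar> = Gamma (real m + \<nu> + 1)"
        using assms G by simp_all
      moreover have "\<bar>fact (Suc m) :: real\<bar> = fact (Suc m)" "\<bar>4 :: real\<bar> = 4"
        by (simp_all del: fact_Suc)
      ultimately show ?thesis
        unfolding b_def Bessel_fps_0_nth[OF assms] norm_of_real
        by (simp only: abs_mult abs_divide power_abs abs_minus abs_inverse abs_one power_one
            divide_inverse inverse_mult_distrib mult_1_left)
    qed
    moreover have "real m + \<nu> + 1 \<noteq> 0" "Gamma (real m + \<nu> + 1) \<noteq> 0"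
      using assms less_imp_neq[OF G] by auto
    moreover have "1 / (x * w) / (1 / (q * x * (fact (Suc m) * 4 ^ Suc m))) = 4 * (real m + 1) * q"
      if "q \<noteq> 0" "x \<noteq> 0" "w = fact m * 4 ^ m" for q x w :: real
      using that by (simp add: field_simps)
    ultimately show ?thesis
      by metis
  qed
  have "filterlim (\<lambda>m. 4 * (real m + 1) * (real m + \<nu> + 1)) at_top sequentially"
    by real_asymp
  hence lim: "(\<lambda>m. ereal (norm (b m) / norm (b (Suc m)))) \<longlonglongrightarrow> \<infinity>"
    by (simp add: ratio tendsto_PInfty_eq_at_top)
  have "conv_radius b = \<infinity>"
    by (rule conv_radius_ratio_limit_ereal_nonzero[OF _ lim]) (use nz in auto)
  thus ?case
    by (simp add: fps_conv_radius_def b_def)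
next
  case (Suc n)
  have "fps_conv_radius (fps_deriv (Bessel_fps \<nu> n)) = \<infinity>"
    using fps_conv_radius_deriv[of "Bessel_fps \<nu> n"] Suc by simp
  hence "fps_conv_radius (fps_const 2 * (fps_X * fps_deriv (Bessel_fps \<nu> n))) = \<infinity>"
    using fps_conv_radius_mult[of fps_X "fps_deriv (Bessel_fps \<nu> n)"]
    by (simp add: fps_conv_radius_cmult_left)
  moreover have "fps_conv_radius (fps_const (of_real (\<nu> - real n)) * Bessel_fps \<nu> n) = \<infinity>"
    using fps_conv_radius_mult[of "fps_const (of_real (\<nu> - real n))" "Bessel_fps \<nu> n"] Suc
    by simp
  ultimately show ?case
    using fps_conv_radius_add[of "fps_const (of_real (\<nu> - real n)) * Bessel_fps \<nu> n"
        "fps_const 2 * (fps_X * fps_deriv (Bessel_fps \<nu> n))"]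
    by (simp add: Bessel_fps_Suc)
qed

lemma Bessel_J_conv_Bessel_fps:
  assumes "\<nu> > -1" "z \<noteq> 0"
  shows "Bessel_J \<nu> z
      = of_real (2 powr (-\<nu>)) * (z powr of_real \<nu> * eval_fps (Bessel_fps \<nu> 0) (z\<^sup>2))"
proof -
  define c where "c = of_real (2 powr (-\<nu>)) * z powr of_real \<nu>"
  have half: "(z / 2) powr of_real \<nu> = c"
  proof -
    have "Ln (z / 2) = Ln z - of_real (ln 2)"
      using Ln_divide_of_real[of 2 z] assms by simp
    hence "of_real \<nu> * Ln (z / 2) = of_real (- \<nu> * ln 2) + of_real \<nu> * Ln z"
      by (simp only: of_real_mult of_real_minus) (simp add: right_diff_distrib)
    hence "exp (of_real \<nu> * Ln (z / 2)) = exp (of_real (- \<nu> * ln 2)) * exp (of_real \<nu> * Ln z)"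
      by (simp only: exp_add)
    thus ?thesis
      using assms by (simp add: c_def powr_def flip: exp_of_real)
  qed
  have pow: "rpow (z / 2) (2 * real m + \<nu>) = c * ((z\<^sup>2) ^ m / 4 ^ m)" for m
  proof -
    have "rpow (z / 2) (2 * real m + \<nu>) = (z / 2) powr (of_nat (2 * m) + of_real \<nu>)"
    proof (cases "2 * real m + \<nu> = 0")
      case True
      hence "of_nat (2 * m) + of_real \<nu> = (0 :: complex)"
        by (metis of_nat_mult of_nat_numeral of_real_0 of_real_add of_real_of_nat_eq)
      thus ?thesis
        using True assms by (simp add: rpow_def)
    qed (simp add: rpow_def)
    also have "\<dots> = (z / 2) ^ (2 * m) * (z / 2) powr of_real \<nu>"
      using assms by (subst powr_add, subst powr_nat) auto
    also have "\<dots> = c * ((z\<^sup>2) ^ m / 4 ^ m)"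
      by (subst half) (simp add: power_mult power_divide power_mult_distrib)
    finally show ?thesis .
  qed
  have "summable (\<lambda>m. fps_nth (Bessel_fps \<nu> 0) m * (z\<^sup>2) ^ m)"
    using assms by (intro summable_fps) auto
  hence "(\<Sum>m. c * (fps_nth (Bessel_fps \<nu> 0) m * (z\<^sup>2) ^ m))
      = c * eval_fps (Bessel_fps \<nu> 0) (z\<^sup>2)"
    unfolding eval_fps_def by (rule suminf_mult)
  moreover have "of_real ((-1) ^ m / (fact m * Gamma (real m + \<nu> + 1)))
        * rpow (z / 2) (2 * real m + \<nu>)
      = c * (fps_nth (Bessel_fps \<nu> 0) m * (z\<^sup>2) ^ m)" for m
    using assms unfolding pow
    by (simp add: Bessel_fps_0_nth rGamma_inverse_Gamma field_simps)
  ultimately show ?thesis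
    by (simp add: Bessel_J_def c_def mult.assoc)
qed

lemma higher_deriv_Bessel_J_aux:
  assumes "\<nu> > -1" "z \<notin> \<real>\<^sub>\<le>\<^sub>0"
  shows "(deriv ^^ n) (Bessel_J \<nu>) z
      = of_real (2 powr (-\<nu>)) * (z powr of_real (\<nu> - real n) * eval_fps (Bessel_fps \<nu> n) (z\<^sup>2))"
  using assms(2)
proof (induction n arbitrary: z)
  case 0
  then show ?case
    using Bessel_J_conv_Bessel_fps[of \<nu> z] assms by (cases "z = 0") auto
next
  case (Suc n)
  define G where "G = (\<lambda>z. of_real (2 powr (-\<nu>))
      * (z powr of_real (\<nu> - real n) * eval_fps (Bessel_fps \<nu> n) (z\<^sup>2)))"
  define B where "B = Bessel_fps \<nu> n"
  have rad: "fps_conv_radius B = \<infinity>" "fps_conv_radius (fps_deriv B) = \<infinity>"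
    using assms fps_conv_radius_deriv[of B] by (simp_all add: B_def)
  have "z \<noteq> 0"
    using Suc.prems by auto
  have "\<forall>\<^sub>F w in nhds z. w \<in> - \<real>\<^sub>\<le>\<^sub>0"
    using Suc.prems by (intro eventually_nhds_in_open) auto
  hence "\<forall>\<^sub>F w in nhds z. (deriv ^^ n) (Bessel_J \<nu>) w = G w"
    by eventually_elim (use Suc.IH in \<open>simp add: G_def\<close>)
  hence "(deriv ^^ Suc n) (Bessel_J \<nu>) z = deriv G z"
    by (auto intro: deriv_cong_ev)
  also have "deriv G z = of_real (2 powr (-\<nu>))
      * (of_real (\<nu> - real n) * z powr (of_real (\<nu> - real n) - 1) * eval_fps B (z\<^sup>2)
        + z powr of_real (\<nu> - real n) * (eval_fps (fps_deriv B) (z\<^sup>2) * (2 * z)))"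
  proof (rule DERIV_imp_deriv)
    have sq: "((\<lambda>z. eval_fps B (z\<^sup>2)) has_field_derivative
        eval_fps (fps_deriv B) (z\<^sup>2) * (2 * z)) (at z)"
    proof (rule DERIV_chain2[where f = "eval_fps B" and g = "\<lambda>z. z\<^sup>2"])
      show "(eval_fps B has_field_derivative eval_fps (fps_deriv B) (z\<^sup>2)) (at (z\<^sup>2))"
        by (rule has_field_derivative_eval_fps) (simp add: rad)
      show "((\<lambda>z. z\<^sup>2) has_field_derivative 2 * z) (at z)"
        by (auto intro!: derivative_eq_intros)
    qed
    have "((\<lambda>z. z powr of_real (\<nu> - real n) * eval_fps B (z\<^sup>2)) has_field_derivative
        of_real (\<nu> - real n) * z powr (of_real (\<nu> - real n) - 1) * eval_fps B (z\<^sup>2)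
        + eval_fps (fps_deriv B) (z\<^sup>2) * (2 * z) * z powr of_real (\<nu> - real n)) (at z)"
      by (rule DERIV_mult[OF has_field_derivative_powr[OF Suc.prems] sq])
    thus "(G has_field_derivative of_real (2 powr (-\<nu>))
      * (of_real (\<nu> - real n) * z powr (of_real (\<nu> - real n) - 1) * eval_fps B (z\<^sup>2)
        + z powr of_real (\<nu> - real n) * (eval_fps (fps_deriv B) (z\<^sup>2) * (2 * z)))) (at z)"
      unfolding G_def B_def[symmetric] by (intro DERIV_cmult) (simp add: mult_ac)
  qed
  also have "z powr of_real (\<nu> - real n) = z powr (of_real (\<nu> - real n) - 1) * z"
    using \<open>z \<noteq> 0\<close> by (simp add: powr_diff)
  also have "of_real (\<nu> - real n) - 1 = (of_real (\<nu> - real (Suc n)) :: complex)"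
    by simp
  also have "of_real (\<nu> - real n) * z powr of_real (\<nu> - real (Suc n)) * eval_fps B (z\<^sup>2)
        + z powr of_real (\<nu> - real (Suc n)) * z * (eval_fps (fps_deriv B) (z\<^sup>2) * (2 * z))
      = z powr of_real (\<nu> - real (Suc n)) * (of_real (\<nu> - real n) * eval_fps B (z\<^sup>2)
        + 2 * (z\<^sup>2 * eval_fps (fps_deriv B) (z\<^sup>2)))"
    by (simp add: algebra_simps power2_eq_square)
  also have "of_real (\<nu> - real n) * eval_fps B (z\<^sup>2) + 2 * (z\<^sup>2 * eval_fps (fps_deriv B) (z\<^sup>2))
      = eval_fps (Bessel_fps \<nu> (Suc n)) (z\<^sup>2)"
  proof -
    have X: "fps_conv_radius (fps_X * fps_deriv B) = \<infinity>"
      using fps_conv_radius_mult[of fps_X "fps_deriv B"] by (simp add: rad)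
    have c: "fps_conv_radius (fps_const a * P) = \<infinity>"
      if "fps_conv_radius P = \<infinity>" for a :: complex and P
      using fps_conv_radius_mult[of "fps_const a" P] that by simp
    show ?thesis
      unfolding Bessel_fps_Suc B_def[symmetric]
      by (simp add: eval_fps_add eval_fps_mult c X rad del: of_real_diff)
  qed
  finally show ?case .
qed

lemma Bessel_E_conv_Bessel_fps:
  assumes "\<nu> > -1"
  shows "Bessel_E \<nu> n z = of_real (Gamma (\<nu> - real n + 1)) * eval_fps (Bessel_fps \<nu> n) (z\<^sup>2)"
proof -
  have "summable (\<lambda>m. fps_nth (Bessel_fps \<nu> n) m * (z\<^sup>2) ^ m)"
    using assms by (intro summable_fps) auto
  hence "of_real (Gamma (\<nu> - real n + 1)) * eval_fps (Bessel_fps \<nu> n) (z\<^sup>2)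
      = (\<Sum>m. of_real (Gamma (\<nu> - real n + 1)) * (fps_nth (Bessel_fps \<nu> n) m * (z\<^sup>2) ^ m))"
    unfolding eval_fps_def by (rule suminf_mult [symmetric])
  also have "\<dots> = Bessel_E \<nu> n z"
    unfolding Bessel_E_def power_mult Bessel_fps_def
    by (rule suminf_cong) (simp add: rGamma_inverse_Gamma divide_inverse mult_ac)
  finally show ?thesis ..
qed

theorem higher_deriv_Bessel_J:
  assumes "\<nu> > real n - 1" "z \<notin> \<real>\<^sub>\<le>\<^sub>0"
  shows "of_real (2 powr \<nu> * Gamma (\<nu> - real n + 1)) * (deriv ^^ n) (Bessel_J \<nu>) z
           = z powr of_real (\<nu> - real n) * Bessel_E \<nu> n z"
proof -
  have "of_real (2 powr \<nu>) * of_real (2 powr (-\<nu>)) = (1 :: complex)"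
    by (simp flip: of_real_mult powr_add)
  thus ?thesis
    using assms by (simp add: higher_deriv_Bessel_J_aux Bessel_E_conv_Bessel_fps mult_ac)
qed

lemma Bessel_E_0:
  assumes "\<nu> > real n - 1"
  shows "Bessel_E \<nu> n 0 = 1"
proof -
  have "Gamma (\<nu> - real n + 1) > 0" "Gamma (\<nu> + 1) > 0"
    using assms by (auto intro!: Gamma_real_pos)
  hence "Gamma (\<nu> - real n + 1) \<noteq> 0" "Gamma (\<nu> + 1) \<noteq> 0"
    by simp_all
  thus ?thesis
    using assms by (simp add: Bessel_E_conv_Bessel_fps eval_fps_at_0 Bessel_fps_def
        rGamma_inverse_Gamma field_simps)
qed

lemma Bessel_E_holomorphic:
  assumes "\<nu> > -1"
  shows "Bessel_E \<nu> n holomorphic_on A"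
proof -
  have "(\<lambda>z. of_real (Gamma (\<nu> - real n + 1)) * eval_fps (Bessel_fps \<nu> n) (z\<^sup>2)) holomorphic_on A"
    using assms
    by (intro holomorphic_intros holomorphic_on_compose_gen[of "\<lambda>z. z\<^sup>2" _ _ UNIV, unfolded o_def])
       auto
  thus ?thesis
    using assms by (simp add: Bessel_E_conv_Bessel_fps cong: holomorphic_cong)
qed

lemma Bessel_f_altdef:
  assumes "\<nu> > real n - 1" "\<nu> \<noteq> real n" "x > 0"
    and "of_real (2 powr \<nu> * Gamma (\<nu> - real n + 1)) * (deriv ^^ n) (Bessel_J \<nu>) (of_real x)
           = of_real j" "j > 0"
  shows "Bessel_f \<nu> n (of_real x) = of_real (j powr (1 / (\<nu> - real n)))"
proof -
  have "of_real j = of_real (x powr (\<nu> - real n)) * Bessel_E \<nu> n (of_real x)"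
    using higher_deriv_Bessel_J[of n \<nu> "of_real x"] assms
      powr_of_real[of x "\<nu> - real n"] by (simp del: of_real_diff)
  hence E: "Bessel_E \<nu> n (of_real x) = of_real (j / x powr (\<nu> - real n))"
    using assms by (simp add: field_simps)
  have "Bessel_f \<nu> n (of_real x)
      = of_real x * of_real ((j / x powr (\<nu> - real n)) powr (1 / (\<nu> - real n)))"
    unfolding Bessel_f_def E using assms by (subst powr_of_real) auto
  also have "(j / x powr (\<nu> - real n)) powr (1 / (\<nu> - real n)) = j powr (1 / (\<nu> - real n)) / x"
    using assms by (simp add: powr_divide powr_powr)
  finally show ?thesis
    using assms by simp
qed

lemma Bessel_g_altdef:
  assumes "\<nu> > real n - 1" "z \<notin> \<real>\<^sub>\<le>\<^sub>0"
  shows "Bessel_g \<nu> n z = of_real (2 powr \<nu> * Gamma (\<nu> - real n + 1))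
           * z powr of_real (1 + real n - \<nu>) * (deriv ^^ n) (Bessel_J \<nu>) z"
proof -
  have "z \<noteq> 0"
    using assms by auto
  have "z powr of_real (1 + real n - \<nu>) * z powr of_real (\<nu> - real n) = z"
    using \<open>z \<noteq> 0\<close> by (simp flip: powr_add)
  hence "Bessel_g \<nu> n z = z powr of_real (1 + real n - \<nu>)
      * (z powr of_real (\<nu> - real n) * Bessel_E \<nu> n z)"
    by (metis Bessel_g_def mult.assoc)
  also note higher_deriv_Bessel_J[OF assms, symmetric]
  finally show ?thesis
    by (simp add: mult_ac)
qed

lemma Bessel_h_altdef:
  assumes "\<nu> > real n - 1" "z \<notin> \<real>\<^sub>\<le>\<^sub>0"
  shows "Bessel_h \<nu> n z = of_real (2 powr \<nu> * Gamma (\<nu> - real n + 1))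
           * z powr of_real (1 + (real n - \<nu>) / 2) * (deriv ^^ n) (Bessel_J \<nu>) (csqrt z)"
proof -
  have "z \<noteq> 0"
    using assms by auto
  have cut: "csqrt z \<notin> \<real>\<^sub>\<le>\<^sub>0"
  proof
    assume "csqrt z \<in> \<real>\<^sub>\<le>\<^sub>0"
    hence "csqrt z = 0"
      using csqrt_principal[of z] by (auto simp: complex_nonpos_Reals_iff complex_eq_iff)
    thus False
      using \<open>z \<noteq> 0\<close> by simp
  qed
  have "csqrt z powr of_real (\<nu> - real n) = z powr of_real ((\<nu> - real n) / 2)"
  proof -
    have "Ln (csqrt z) = Ln z / 2"
      using \<open>z \<noteq> 0\<close> mpi_less_Im_Ln[of z] Im_Ln_le_pi[of z] pi_gt_zero
      unfolding csqrt_exp_Ln[OF \<open>z \<noteq> 0\<close>] by (intro Ln_exp) (simp_all del: mpi_less_Im_Ln Im_Ln_le_pi)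
    hence "of_real (\<nu> - real n) * Ln (csqrt z) = of_real ((\<nu> - real n) / 2) * Ln z"
      by (simp only: of_real_divide) simp
    thus ?thesis
      using \<open>z \<noteq> 0\<close> unfolding powr_def by (simp only: csqrt_eq_0 if_False)
  qed
  hence "z powr of_real (1 + (real n - \<nu>) / 2) * csqrt z powr of_real (\<nu> - real n)
      = z powr (of_real (1 + (real n - \<nu>) / 2) + of_real ((\<nu> - real n) / 2))"
    by (simp only: powr_add)
  also have "of_real (1 + (real n - \<nu>) / 2) + of_real ((\<nu> - real n) / 2) = (1 :: complex)"
    by (simp add: field_simps)
  finally have "z powr of_real (1 + (real n - \<nu>) / 2) * csqrt z powr of_real (\<nu> - real n) = z"
    using \<open>z \<noteq> 0\<close> by simp
  hence "Bessel_h \<nu> n z = z powr of_real (1 + (real n - \<nu>) / 2)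
      * (csqrt z powr of_real (\<nu> - real n) * Bessel_E \<nu> n (csqrt z))"
    by (metis Bessel_h_def mult.assoc)
  also note higher_deriv_Bessel_J[OF assms(1) cut, symmetric]
  finally show ?thesis
    by (simp add: mult_ac)
qed

end

theory Submission
  imports Defs
begin

text \<open>
  With \<open>E(z) = H(z\<^sup>2)\<close> and \<open>\<phi>(w) = w H'(w) / H(w)\<close>, each of the three quotients \<open>z f'(z) / f(z)\<close> has the form
  \<open>1 + k c \<phi>(z\<^sup>k)\<close>. The entire function \<open>H\<close> is the locally uniform limit of polynomials
  \<open>\<Prod> (1 - w/a)\<close> with positive zeros: Rodrigues' formula builds Laguerre polynomials by steps that keep all
  zeros positive and simple (Rolle), and so does the operator \<open>p \<mapsto> (\<nu> - j) p + 2 x p'\<close> corresponding to the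
  passage from \<open>J\<^sub>\<nu>\<close> to its derivatives; rescaled Laguerre polynomials tend to the Bessel series. For such
  products \<open>\<phi>(w) = - \<Sum> w/(a - w)\<close>, so \<open>\<phi>(|w|) \<le> Re \<phi>(w) \<le> \<phi>(-|w|)\<close> up to the first zero,
  and these inequalities survive the limit. Hence the condition \<open>Re > \<beta>\<close> first fails on the positive axis
  if \<open>c > 0\<close>, and on the imaginary axis if \<open>c < 0\<close> and \<open>k = 2\<close>. In the latter case the critical value of
  \<open>\<phi>(-r)\<close> is below \<open>1/2\<close>, which forces it to be attained before the first zero of \<open>H\<close>.
\<close>

section \<open>Polynomials with positive simple zeros\<close>

text \<open>Counts the zeros that Rolle-type arguments produce. The origin serves as an extra left
  endpoint, so there are as many gaps as points of \<open>S\<close>. Choosing one point in the gap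
  just below each \<open>b\<close> makes the choice strictly increasing, hence injective; the bound
  by the maximum leaves room for a further zero beyond it.\<close>

lemma gap_points:
  fixes S :: "real set" and Q :: "real \<Rightarrow> bool"
  assumes S: "finite S" "\<And>x. x \<in> S \<Longrightarrow> 0 < x"
    and Q: "\<And>a b. a \<in> insert 0 S \<Longrightarrow> b \<in> S \<Longrightarrow> a < b \<Longrightarrow> \<exists>x>a. x < b \<and> Q x"
  shows "\<exists>T. finite T \<and> card T = card S \<and> (\<forall>x\<in>T. 0 < x \<and> x < Max (insert 0 S) \<and> Q x)"
proof -
  define prev where "prev b = Max (insert 0 {a \<in> S. a < b})" for b
  have prev_in: "prev b \<in> insert 0 S" "prev b < b" if "b \<in> S" for b
  proof -
    have "prev b \<in> insert 0 {a \<in> S. a < b}"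
      unfolding prev_def by (rule Max_in) (use S in auto)
    thus "prev b \<in> insert 0 S" "prev b < b"
      using that S(2) by auto
  qed
  have le_prev: "a \<le> prev b" if "a \<in> S" "a < b" for a b
    unfolding prev_def using that S(1) by (intro Max_ge) auto
  have "\<forall>b\<in>S. \<exists>x>prev b. x < b \<and> Q x"
    using Q prev_in by blast
  then obtain \<xi> where \<xi>: "\<And>b. b \<in> S \<Longrightarrow> prev b < \<xi> b \<and> \<xi> b < b \<and> Q (\<xi> b)"
    by metis
  have less: "\<xi> a < \<xi> b" if "a \<in> S" "b \<in> S" "a < b" for a b
    using \<xi>[of a] \<xi>[of b] le_prev[of a b] that by linarith
  have "inj_on \<xi> S"
    by (rule inj_onI) (metis less less_irrefl linorder_cases)
  moreover have "0 < \<xi> b" if "b \<in> S" for b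
    using \<xi>[OF that] prev_in[OF that] S(2) by force
  moreover have "\<xi> b < Max (insert 0 S)" if "b \<in> S" for b
  proof -
    have "b \<le> Max (insert 0 S)"
      using S(1) that by (intro Max_ge) auto
    thus ?thesis using \<xi>[OF that] by linarith
  qed
  ultimately show ?thesis
    using S(1) \<xi> by (intro exI[of _ "\<xi> ` S"]) (auto simp: card_image)
qed

text \<open>Distinct zeros are counted against the degree, so all complex zeros are real, positive
  and simple, and multiplicities never have to be mentioned.\<close>

definition pos_rooted :: "real poly \<Rightarrow> bool" where
  "pos_rooted p \<longleftrightarrow> p \<noteq> 0 \<and> card {x. 0 < x \<and> poly p x = 0} = degree p"

text \<open>A lower bound on the number of positive zeros suffices, because a nonzero polynomial has
  at most as many zeros as its degree.\<close>

lemma pos_rootedI: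
  assumes "p \<noteq> 0" "degree p \<le> card T" "\<And>x. x \<in> T \<Longrightarrow> 0 < x \<and> poly p x = 0"
  shows "pos_rooted p"
proof -
  have fin: "finite {x. 0 < x \<and> poly p x = 0}"
    by (rule finite_subset[OF _ poly_roots_finite[OF \<open>p \<noteq> 0\<close>]]) auto
  have "card T \<le> card {x. 0 < x \<and> poly p x = 0}"
    using assms by (intro card_mono fin) auto
  moreover have "card {x. 0 < x \<and> poly p x = 0} \<le> card {x. poly p x = 0}"
    by (intro card_mono poly_roots_finite assms) auto
  ultimately show ?thesis
    using assms card_poly_roots_bound[of p] by (simp add: pos_rooted_def)
qed

text \<open>For \<open>x > 0\<close> the new polynomial is \<open>2 x^(1 - a/2)\<close> times the
  derivative of \<open>x^(a/2) p(x)\<close>, which vanishes at 0 and at the zeros of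
  \<open>p\<close>. Rolle's theorem yields one zero per gap. The degree does not grow, since the
  coefficient of \<open>x^m\<close> is merely multiplied by \<open>a + 2 m\<close>.\<close>

lemma pos_rooted_euler:
  assumes p: "pos_rooted p" and a: "a > 0"
  shows "pos_rooted (smult a p + smult 2 (pCons 0 (pderiv p)))" (is "pos_rooted ?q")
proof -
  define S where "S = {x. 0 < x \<and> poly p x = 0}"
  have fin: "finite S"
    unfolding S_def using p
    by (intro finite_subset[OF _ poly_roots_finite[of p]]) (auto simp: pos_rooted_def)
  have Q: "\<exists>x>u. x < v \<and> poly ?q x = 0" if uv: "u \<in> insert 0 S" "v \<in> S" "u < v" for u v
  proof -
    define f where "f x = x powr (a / 2) * poly p x" for x
    have "u \<ge> 0" using uv by (auto simp: S_def)
    have "f u = f v"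
      using uv by (auto simp: f_def S_def)
    moreover have "continuous_on {u..v} f"
      unfolding f_def using \<open>u \<ge> 0\<close> a by (intro continuous_intros continuous_on_powr') auto
    moreover have d: "(f has_real_derivative
        a / 2 * x powr (a / 2 - 1) * poly p x + x powr (a / 2) * poly (pderiv p) x) (at x)"
      if "x > 0" for x
      unfolding f_def using that by (auto intro!: derivative_eq_intros)
    hence "f differentiable (at x)" if "u < x" "x < v" for x
      using that \<open>u \<ge> 0\<close> d[of x] unfolding real_differentiable_def by (meson le_less_trans)
    ultimately obtain x where x: "u < x" "x < v" "(f has_real_derivative 0) (at x)"
      using Rolle[OF \<open>u < v\<close>, of f] by blast
    hence "a / 2 * x powr (a / 2 - 1) * poly p x + x powr (a / 2) * poly (pderiv p) x = 0"
      using d[of x] \<open>u \<ge> 0\<close> by (intro DERIV_unique[of f _ x]) auto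
    moreover have "x powr (a / 2) = x powr (a / 2 - 1) * x"
      using x \<open>u \<ge> 0\<close> by (simp add: powr_diff)
    ultimately have "x powr (a / 2 - 1) * (a / 2 * poly p x + x * poly (pderiv p) x) = 0"
      by (simp add: algebra_simps)
    hence "a / 2 * poly p x + x * poly (pderiv p) x = 0"
      using x \<open>u \<ge> 0\<close> by auto
    thus ?thesis using x by (intro exI[of _ x]) (auto simp: algebra_simps)
  qed
  obtain T where T: "finite T" "card T = card S" "\<forall>x\<in>T. 0 < x \<and> x < Max (insert 0 S) \<and> poly ?q x = 0"
    using gap_points[OF fin, of "\<lambda>x. poly ?q x = 0"] Q by (auto simp: S_def)
  have coeff: "coeff ?q m = (a + 2 * real m) * coeff p m" for m
    by (cases m) (auto simp: coeff_pCons coeff_pderiv algebra_simps)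
  have "coeff ?q (degree p) \<noteq> 0"
    unfolding coeff using a p by (auto simp: pos_rooted_def add_nonneg_eq_0_iff)
  hence "?q \<noteq> 0" by (metis coeff_0)
  moreover have "degree ?q \<le> degree p"
    by (rule degree_le) (simp only: coeff, simp add: coeff_eq_0)
  ultimately show ?thesis
    using T p by (intro pos_rootedI[of _ T]) (auto simp: pos_rooted_def S_def)
qed

text \<open>Rolle's theorem on a half-line. If \<open>f (a + 1) > 0\<close>, the decay of
  \<open>f\<close> yields a \<open>T\<close> with \<open>f T < f (a + 1)\<close>, so the maximum
  over the compact interval from \<open>a\<close> to \<open>T\<close> is attained inside it. A
  negative value is treated by passing to \<open>- f\<close>, and the value 0 is ordinary
  Rolle.\<close>

lemma exists_critical_point_at_top:
  fixes f :: "real \<Rightarrow> real"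
  assumes d: "\<And>x. x > a \<Longrightarrow> (f has_real_derivative f' x) (at x)"
    and cont: "continuous_on {a..} f" and a: "f a = 0" and lim: "(f \<longlongrightarrow> 0) at_top"
  shows "\<exists>x>a. f' x = 0"
proof -
  have pos: "\<exists>x>a. g' x = 0"
    if d: "\<And>x. x > a \<Longrightarrow> (g has_real_derivative g' x) (at x)"
      and cont: "continuous_on {a..} g" and a: "g a = 0" and lim: "(g \<longlongrightarrow> 0) at_top"
      and p: "g (a + 1) > 0" for g g' :: "real \<Rightarrow> real"
  proof -
    have "eventually (\<lambda>x. g x < g (a + 1) \<and> x > a + 1) at_top"
      using order_tendstoD(2)[OF lim p] eventually_gt_at_top by (rule eventually_conj)
    then obtain T where T: "g T < g (a + 1)" "T > a + 1"
      by (auto dest!: eventually_happens'[OF trivial_limit_at_top_linorder])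
    have "continuous_on {a..T} g"
      by (rule continuous_on_subset[OF cont]) auto
    then obtain x where x: "x \<in> {a..T}" "\<forall>y\<in>{a..T}. g y \<le> g x"
      using continuous_attains_sup[of "{a..T}" g] T by auto
    have "g (a + 1) \<le> g x"
      using x T by auto
    hence ne: "a < x" "x < T"
    proof -
      have "x \<noteq> a" "x \<noteq> T"
        using \<open>g (a + 1) \<le> g x\<close> T p a by auto
      thus "a < x" "x < T" using x by auto
    qed
    have "g' x = 0"
      using ne x by (intro DERIV_local_max[OF d, of x "min (x - a) (T - x)"]) (auto simp: abs_if split: if_splits)
    thus ?thesis using ne by blast
  qed
  consider "f (a + 1) > 0" | "f (a + 1) < 0" | "f (a + 1) = 0" by linarith
  thus ?thesis
  proof cases
    case 1
    thus ?thesis using pos[of f f'] assms by blast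
  next
    case 2
    have "\<exists>x>a. - f' x = 0"
      using 2 a tendsto_minus[OF lim]
      by (intro pos[of "\<lambda>x. - f x"] continuous_on_minus cont) (auto intro!: DERIV_minus d)
    thus ?thesis by auto
  next
    case 3
    have diff: "f differentiable (at x)" if "x > a" for x
      using d[OF that] unfolding real_differentiable_def by blast
    have "\<exists>z>a. z < a + 1 \<and> (f has_real_derivative 0) (at z)"
      using 3 a by (intro Rolle continuous_on_subset[OF cont] diff) auto
    thus ?thesis using d DERIV_unique by blast
  qed
qed

text \<open>The derivative of \<open>x^a exp(-x) p(x)\<close> is \<open>x^(a - 1) exp(-x)\<close>
  times the new polynomial. Rolle gives one zero below each zero of \<open>p\<close>, and the
  exponential decay gives one more beyond the largest, which matches the increase of the degree by
  one.\<close>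

lemma pos_rooted_laguerre_step:
  assumes p: "pos_rooted p" and a: "a > 0"
  shows "pos_rooted ([:a, -1:] * p + pCons 0 (pderiv p))" (is "pos_rooted ?q")
proof -
  define S where "S = {x. 0 < x \<and> poly p x = 0}"
  have fin: "finite S"
    unfolding S_def using p
    by (intro finite_subset[OF _ poly_roots_finite[of p]]) (auto simp: pos_rooted_def)
  define f where "f x = x powr a * exp (-x) * poly p x" for x
  have f0: "f u = 0" if "u \<in> insert 0 S" for u
    using that by (auto simp: f_def S_def)
  have cont: "continuous_on A f" if "A \<subseteq> {0..}" for A
    unfolding f_def using that a by (intro continuous_intros continuous_on_powr') auto
  have d: "(f has_real_derivative x powr (a - 1) * exp (-x) * poly ?q x) (at x)" if "x > 0" for x
  proof -
    have "(f has_real_derivative (a * x powr (a - 1) * exp (-x) - x powr a * exp (-x)) * poly p x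
        + x powr a * exp (-x) * poly (pderiv p) x) (at x)"
      unfolding f_def using that
      by (auto intro!: derivative_eq_intros simp: algebra_simps)
    moreover have "x powr a = x powr (a - 1) * x"
      using that by (simp add: powr_diff)
    ultimately show ?thesis
      by (simp add: algebra_simps)
  qed
  have diff: "f differentiable (at x)" if "x > 0" for x
    using d[OF that] unfolding real_differentiable_def by blast
  have lim: "(f \<longlongrightarrow> 0) at_top"
  proof -
    have "((\<lambda>x. \<Sum>i\<le>degree p. coeff p i * (x powr a * exp (-x) * x ^ i)) \<longlongrightarrow> (\<Sum>i\<le>degree p. coeff p i * 0)) at_top"
    proof (intro tendsto_sum tendsto_mult_left)
      fix i show "((\<lambda>x::real. x powr a * exp (-x) * x ^ i) \<longlongrightarrow> 0) at_top"
        by real_asymp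
    qed
    thus ?thesis
      unfolding f_def poly_altdef by (simp add: sum_distrib_left mult_ac)
  qed
  have Q: "\<exists>x>u. x < v \<and> poly ?q x = 0" if uv: "u \<in> insert 0 S" "v \<in> S" "u < v" for u v
  proof -
    have "u \<ge> 0" using uv by (auto simp: S_def)
    have "\<exists>x>u. x < v \<and> (f has_real_derivative 0) (at x)"
      using uv f0[of u] f0[of v] \<open>u \<ge> 0\<close> by (intro Rolle cont diff) auto
    then obtain x where x: "u < x" "x < v" "(f has_real_derivative 0) (at x)" by blast
    hence "x powr (a - 1) * exp (-x) * poly ?q x = 0"
      using d[of x] \<open>u \<ge> 0\<close> by (intro DERIV_unique[of f _ x]) auto
    thus ?thesis using x \<open>u \<ge> 0\<close> by (intro exI[of _ x]) auto
  qed
  obtain T where T: "finite T" "card T = card S" "\<forall>x\<in>T. 0 < x \<and> x < Max (insert 0 S) \<and> poly ?q x = 0"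
    using gap_points[OF fin, of "\<lambda>x. poly ?q x = 0"] Q by (auto simp: S_def)
  \<comment> \<open>If \<open>p\<close> is constant, \<open>M\<close> is 0 and the additional zero
    comes from the half-line starting at the origin.\<close>
  define M where "M = Max (insert 0 S)"
  have M: "M \<in> insert 0 S" "M \<ge> 0"
    unfolding M_def using fin Max_in[of "insert 0 S"] by auto
  have "\<exists>x>M. x powr (a - 1) * exp (-x) * poly ?q x = 0"
    using M f0 d by (intro exists_critical_point_at_top[of M f] cont lim) auto
  then obtain y where y: "y > M" "poly ?q y = 0"
    using M by auto
  have "y \<notin> T" using T y by (force simp: M_def)
  have "p \<noteq> 0" using p by (auto simp: pos_rooted_def)
  have c: "coeff ?q (Suc (degree p)) \<noteq> 0"
    using \<open>p \<noteq> 0\<close> by (simp add: coeff_pderiv coeff_eq_0)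
  hence "?q \<noteq> 0" by (metis coeff_0)
  moreover have "degree ?q \<le> Suc (degree p)"
  proof (rule degree_add_le)
    show "degree ([:a, -1:] * p) \<le> Suc (degree p)"
      using degree_mult_le[of "[:a, -1:]" p] by simp
  qed (use degree_pCons_le[of 0 "pderiv p"] in \<open>simp add: degree_pderiv\<close>)
  ultimately show ?thesis
    using T p y M \<open>y \<notin> T\<close> by (intro pos_rootedI[of _ "insert y T"]) (auto simp: pos_rooted_def S_def)
qed

section \<open>Laguerre polynomials and their Bessel analogues\<close>

text \<open>Up to a constant factor, this is the Laguerre polynomial \<open>L\<^sub>k^(\<mu>)\<close>.\<close>
definition laguerre_poly :: "real \<Rightarrow> nat \<Rightarrow> real poly" where
  "laguerre_poly \<mu> k = Poly (map (\<lambda>m. (-1) ^ m * real (k choose m) * rGamma (real m + \<mu> + 1)) [0..<Suc k])"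

lemma coeff_laguerre_poly:
  "coeff (laguerre_poly \<mu> k) m = (-1) ^ m * real (k choose m) * rGamma (real m + \<mu> + 1)"
  by (auto simp: laguerre_poly_def nth_default_def simp del: upt_Suc)

text \<open>Rodrigues' formula, one factor at a time.\<close>
lemma laguerre_poly_Suc:
  "laguerre_poly \<mu> (Suc k) = [:\<mu> + 1, -1:] * laguerre_poly (\<mu> + 1) k + pCons 0 (pderiv (laguerre_poly (\<mu> + 1) k))"
proof (rule poly_eqI)
  fix m
  have rG: "rGamma (real m + \<mu> + 1) = (real m + \<mu> + 1) * rGamma (real m + (\<mu> + 1) + 1)" for m
    using rGamma_plus1[of "real m + \<mu> + 1"] by (simp add: add_ac)
  show "coeff (laguerre_poly \<mu> (Suc k)) m = coeff ([:\<mu> + 1, -1:] * laguerre_poly (\<mu> + 1) k + pCons 0 (pderiv (laguerre_poly (\<mu> + 1) k))) m"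
  proof (cases m)
    case 0
    thus ?thesis using rG[of 0] by (simp add: coeff_laguerre_poly coeff_pderiv)
  next
    case (Suc j)
    have 1: "rGamma (real j + (\<mu> + 1) + 1) = (real j + \<mu> + 2) * rGamma (real (Suc j) + (\<mu> + 1) + 1)"
      using rG[of "Suc j"] by (simp add: add_ac)
    show ?thesis
      unfolding Suc using rG[of "Suc j"]
      by (simp add: coeff_laguerre_poly coeff_pderiv 1 algebra_simps)
  qed
qed

text \<open>The parameter is generalized because Rodrigues' step reaches degree \<open>k + 1\<close>
  at \<open>\<mu>\<close> from degree \<open>k\<close> at \<open>\<mu> + 1\<close>. The exponent of
  its weight is \<open>\<mu> + 1 > 0\<close>.\<close>

lemma pos_rooted_laguerre_poly: "\<mu> > -1 \<Longrightarrow> pos_rooted (laguerre_poly \<mu> k)"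
proof (induction k arbitrary: \<mu>)
  case 0
  have "rGamma (\<mu> + 1) \<noteq> 0"
    using 0 Gamma_real_pos[of "\<mu> + 1"] by (simp add: rGamma_inverse_Gamma less_imp_neq[THEN not_sym])
  hence "laguerre_poly \<mu> 0 \<noteq> 0" "degree (laguerre_poly \<mu> 0) = 0"
    by (auto simp: laguerre_poly_def)
  thus ?case by (intro pos_rootedI[of _ "{}"]) auto
next
  case (Suc k)
  thus ?case
    unfolding laguerre_poly_Suc by (intro pos_rooted_laguerre_step) auto
qed

text \<open>The recursion copies \<open>Bessel_fps_Suc\<close>: differentiating
  \<open>z^(\<nu> - n) B(z^2)\<close> turns \<open>B(w)\<close> into
  \<open>(\<nu> - n) B + 2 w B'\<close>, apart from the power of \<open>z\<close>.\<close>

primrec Bessel_poly :: "real \<Rightarrow> nat \<Rightarrow> nat \<Rightarrow> real poly" where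
  "Bessel_poly \<nu> 0 k = laguerre_poly \<nu> k"
| "Bessel_poly \<nu> (Suc n) k = smult (\<nu> - real n) (Bessel_poly \<nu> n k)
     + smult 2 (pCons 0 (pderiv (Bessel_poly \<nu> n k)))"

text \<open>Differentiation number \<open>j + 1\<close> uses the factor \<open>\<nu> - j\<close>
  with \<open>j \<le> n - 1\<close>, and the bound on \<open>\<nu>\<close> keeps all these factors
  positive.\<close>

lemma pos_rooted_Bessel_poly:
  assumes "\<nu> > real n - 1"
  shows "pos_rooted (Bessel_poly \<nu> n k)"
    using assms
proof (induction n)
  case (Suc n)
  thus ?case unfolding Bessel_poly.simps by (intro pos_rooted_euler) auto
qed (simp add: pos_rooted_laguerre_poly)

text \<open>Each differentiation multiplies the coefficient number \<open>m\<close> of polynomial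
  and series alike by \<open>\<nu> - n + 2 m\<close>, so their ratio remains the one of the Laguerre
  case.\<close>

lemma coeff_Bessel_poly:
  assumes "\<nu> > -1"
  shows "of_real (coeff (Bessel_poly \<nu> n k) m)
    = fps_nth (Bessel_fps \<nu> n) m * of_real (fact m * 4 ^ m * real (k choose m))"
proof (induction n)
  case 0
  thus ?case using assms by (simp add: coeff_laguerre_poly Bessel_fps_0_nth)
next
  case (Suc n)
  have "coeff (Bessel_poly \<nu> (Suc n) k) m = (\<nu> - real n + 2 * real m) * coeff (Bessel_poly \<nu> n k) m"
    by (cases m) (auto simp: coeff_pCons coeff_pderiv algebra_simps)
  moreover have "fps_nth (Bessel_fps \<nu> (Suc n)) m = of_real (\<nu> - real n + 2 * real m) * fps_nth (Bessel_fps \<nu> n) m"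
    unfolding Bessel_fps_Suc by (cases m) (simp_all add: algebra_simps)
  ultimately show ?case using Suc by (simp only: of_real_mult) simp
qed

text \<open>Both sides have degree at most \<open>card A\<close> and agree on \<open>A\<close> and
  at 0, which is one point more than the degree allows for distinct polynomials.\<close>

lemma poly_eq_prod_roots:
  fixes p :: "'a::field poly"
  assumes "finite A" "degree p \<le> card A" "\<And>a. a \<in> A \<Longrightarrow> a \<noteq> 0 \<and> poly p a = 0"
  shows "poly p x = poly p 0 * (\<Prod>a\<in>A. 1 - x / a)"
proof -
  define q where "q = smult (poly p 0) (\<Prod>a\<in>A. [:1, -1/a:])"
  have q: "poly q x = poly p 0 * (\<Prod>a\<in>A. 1 - x / a)" for x
    by (simp add: q_def poly_prod)
  have "p = q"
  proof (rule poly_eqI_degree[of "insert 0 A"])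
    show "poly p x = poly q x" if "x \<in> insert 0 A" for x
    proof (cases "x = 0")
      case False
      with that have "(\<Prod>a\<in>A. 1 - x / a) = 0"
        using assms by (intro prod_zero) (auto intro!: bexI[of _ x])
      thus ?thesis using False that assms by (simp add: q)
    qed (simp add: q)
    have c: "card (insert 0 A) = Suc (card A)"
      using assms by (subst card_insert_disjoint) auto
    show "degree p < card (insert 0 A)" using c assms by simp
    have "degree q \<le> degree (\<Prod>a\<in>A. [:1, -1/a:])"
      unfolding q_def by (rule degree_smult_le)
    also have "\<dots> \<le> sum (degree \<circ> (\<lambda>a. [:1, -1/a:])) A"
      by (rule degree_prod_sum_le[OF assms(1)])
    also have "\<dots> \<le> sum (\<lambda>_. 1) A"
      by (intro sum_mono) (auto simp: o_def intro: order.trans[OF degree_pCons_le])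
    finally show "degree q < card (insert 0 A)" using c by simp
  qed
  hence "poly p x = poly q x" by (rule arg_cong)
  also note q
  finally show ?thesis .
qed

section \<open>Limits of products with positive zeros\<close>

text \<open>The zero set in the interval is closed and, by the intermediate value theorem, nonempty;
  its infimum is the first zero. A nonpositive value before it would produce an earlier
  zero.\<close>

lemma first_zero:
  fixes g :: "real \<Rightarrow> real"
  assumes cont: "continuous_on {0..t} g" and "0 \<le> t" "g 0 > 0" "g t \<le> 0"
  shows "\<exists>s>0. s \<le> t \<and> g s = 0 \<and> (\<forall>u\<in>{0..<s}. g u > 0)"
proof -
  define Z where "Z = {u \<in> {0..t}. g u = 0}"
  have "\<exists>x\<ge>0. x \<le> t \<and> g x = 0"
    using assms by (intro IVT2') auto
  hence "Z \<noteq> {}" by (auto simp: Z_def)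
  moreover have "closed Z"
    unfolding Z_def by (intro continuous_closed_preimage_constant cont) auto
  moreover have "bdd_below Z" by (auto simp: Z_def)
  ultimately have "Inf Z \<in> Z" using closed_contains_Inf by blast
  define s where "s = Inf Z"
  have s: "0 \<le> s" "s \<le> t" "g s = 0"
    using \<open>Inf Z \<in> Z\<close> by (auto simp: s_def Z_def)
  have pos: "g u > 0" if "u \<in> {0..<s}" for u
  proof (rule ccontr)
    assume "\<not> g u > 0"
    hence "\<exists>x\<ge>0. x \<le> u \<and> g x = 0"
      using that s assms by (intro IVT2' continuous_on_subset[OF cont]) auto
    then obtain x where x: "0 \<le> x" "x \<le> u" "g x = 0" by blast
    hence "x \<in> Z" "x < s"
      using that s by (auto simp: Z_def)
    thus False
      unfolding s_def using \<open>bdd_below Z\<close> cInf_lower by fastforce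
  qed
  have "s \<noteq> 0" using s \<open>g 0 > 0\<close> by auto
  thus ?thesis using s pos by (intro exI[of _ s]) auto
qed

text \<open>The derivative of \<open>log H\<close> with respect to \<open>log w\<close>, so that
  products become sums. It serves both for \<open>H\<close> in the variable \<open>w\<close> and for
  the starlikeness quotient of the normalized functions in \<open>z\<close>.\<close>

definition euler_quot :: "(complex \<Rightarrow> complex) \<Rightarrow> complex \<Rightarrow> complex" where
  "euler_quot H w = w * deriv H w / H w"

lemma Re_div_diff_le:
  assumes "norm w < a"
  shows "Re (w / (of_real a - w)) \<le> norm w / (a - norm w)"
proof -
  have "a - norm w \<le> norm (of_real a - w)"
    using assms norm_triangle_ineq2[of "of_real a" w] by simp
  have "Re (w / (of_real a - w)) \<le> norm (w / (of_real a - w))" by (rule complex_Re_le_cmod)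
  also have "\<dots> \<le> norm w / (a - norm w)"
    unfolding norm_divide using \<open>a - norm w \<le> _\<close> assms by (intro divide_left_mono mult_pos_pos) auto
  finally show ?thesis .
qed

text \<open>Equality holds at \<open>w = - norm w\<close>. After clearing denominators, the
  difference of the two sides is \<open>a (a - r) (r + x)\<close>, with \<open>r\<close> the modulus
  and \<open>x\<close> the real part of \<open>w\<close>.\<close>

lemma Re_div_diff_ge:
  assumes "norm w < a"
  shows "Re (w / (of_real a - w)) \<ge> - norm w / (a + norm w)"
proof -
  define r x where "r = norm w" and "x = Re w"
  have r: "r < a" "0 \<le> r" "\<bar>x\<bar> \<le> r" "r\<^sup>2 = x\<^sup>2 + (Im w)\<^sup>2"
    using assms abs_Re_le_cmod[of w] by (auto simp: r_def x_def cmod_power2)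
  have d: "0 < (a - x)\<^sup>2 + (Im w)\<^sup>2"
    using r by (intro add_pos_nonneg) auto
  have "Re (w / (of_real a - w)) = (x * (a - x) - (Im w)\<^sup>2) / ((a - x)\<^sup>2 + (Im w)\<^sup>2)"
    by (simp add: Re_divide x_def power2_eq_square)
  moreover have "- r * ((a - x)\<^sup>2 + (Im w)\<^sup>2) \<le> (x * (a - x) - (Im w)\<^sup>2) * (a + r)"
  proof -
    have "(x * (a - x) - (Im w)\<^sup>2) * (a + r) - (- r * ((a - x)\<^sup>2 + (Im w)\<^sup>2))
        = (x * a - r\<^sup>2) * (a + r) + r * (a\<^sup>2 - 2 * a * x + r\<^sup>2)"
      using r(4) by (simp add: power2_eq_square algebra_simps)
    also have "\<dots> = a * ((a - r) * (r + x))"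
      by (simp add: power2_eq_square algebra_simps)
    also have "\<dots> \<ge> 0" using r by (intro mult_nonneg_nonneg) auto
    finally show ?thesis by linarith
  qed
  ultimately have "Re (w / (of_real a - w)) \<ge> - r / (a + r)"
    using d r by (simp add: divide_le_eq pos_le_divide_eq mult.commute field_simps)
  thus ?thesis by (simp add: r_def)
qed


section \<open>Finite products with positive zeros\<close>

locale finite_product =
  fixes A :: "real set" and P :: "complex \<Rightarrow> complex"
  assumes finite_zeros: "finite A" and zeros_pos: "\<And>a. a \<in> A \<Longrightarrow> 0 < a"
  defines "P \<equiv> \<lambda>w. \<Prod>a\<in>A. 1 - w / of_real a"
begin

lemma holomorphic: "P holomorphic_on X"
  unfolding P_def by (intro holomorphic_intros) (use zeros_pos in force)

lemma eval_of_real: "P (of_real t) = of_real (\<Prod>a\<in>A. 1 - t / a)"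
  by (simp add: P_def)

lemma eq_0: "a \<in> A \<Longrightarrow> P (of_real a) = 0"
  using finite_zeros zeros_pos unfolding P_def by (force intro!: prod_zero)

lemma nonzero:
  assumes "\<And>a. a \<in> A \<Longrightarrow> norm w < a"
  shows "P w \<noteq> 0"
  unfolding P_def using finite_zeros assms zeros_pos by (force simp: field_simps)

text \<open>Holds factor by factor by the triangle inequality. In the limit it turns positivity on
  the real interval into absence of zeros in the whole disc.\<close>

lemma norm_ge:
  assumes "\<And>a. a \<in> A \<Longrightarrow> norm w < a"
  shows "Re (P (of_real (norm w))) \<le> norm (P w)"
proof -
  have "(\<Prod>a\<in>A. 1 - norm w / a) \<le> (\<Prod>a\<in>A. norm (1 - w / of_real a))"
  proof (rule prod_mono)
    fix a assume a: "a \<in> A"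
    have "1 - norm w / a \<le> norm (1 - w / of_real a)"
      using norm_triangle_ineq2[of 1 "w / of_real a"] zeros_pos[OF a] by (simp add: norm_divide)
    thus "0 \<le> 1 - norm w / a \<and> 1 - norm w / a \<le> norm (1 - w / of_real a)"
      using assms[OF a] zeros_pos[OF a] by (simp add: field_simps)
  qed
  thus ?thesis
    unfolding eval_of_real Re_complex_of_real by (simp add: P_def prod_norm)
qed

lemma deriv_eq:
  assumes "\<And>a. a \<in> A \<Longrightarrow> norm w < a"
  shows "deriv P w = - P w * (\<Sum>a\<in>A. 1 / (of_real a - w))"
proof -
  have ne: "of_real a - w \<noteq> 0" "of_real a \<noteq> (0::complex)" "1 - w / of_real a \<noteq> 0" if "a \<in> A" for a
    using assms[OF that] zeros_pos[OF that] by (auto simp: field_simps)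
  have "((\<lambda>w. \<Prod>a\<in>A. 1 - w / of_real a) has_field_derivative
      (\<Prod>a\<in>A. 1 - w / of_real a) * (\<Sum>a\<in>A. (- 1 / of_real a) / (1 - w / of_real a))) (at w)"
    using ne by (intro has_field_derivative_prod') (auto intro!: derivative_eq_intros)
  hence "deriv P w = P w * (\<Sum>a\<in>A. (- 1 / of_real a) / (1 - w / of_real a))"
    unfolding P_def by (rule DERIV_imp_deriv)
  also have "(\<Sum>a\<in>A. (- 1 / of_real a) / (1 - w / of_real a)) = (\<Sum>a\<in>A. - (1 / (of_real a - w)))"
    using ne by (intro sum.cong) (auto simp: divide_simps)
  finally show ?thesis by (simp add: sum_negf)
qed

lemma euler_quot_eq:
  assumes "\<And>a. a \<in> A \<Longrightarrow> norm w < a"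
  shows "euler_quot P w = - (\<Sum>a\<in>A. w / (of_real a - w))"
proof -
  have "euler_quot P w = - (w * (\<Sum>a\<in>A. 1 / (of_real a - w)))"
    using nonzero[OF assms] by (simp add: euler_quot_def deriv_eq[OF assms])
  thus ?thesis by (simp add: sum_distrib_left)
qed

lemma euler_quot_of_real:
  assumes "\<And>a. a \<in> A \<Longrightarrow> \<bar>t\<bar> < a"
  shows "Re (euler_quot P (of_real t)) = - (\<Sum>a\<in>A. t / (a - t))"
proof -
  have "euler_quot P (of_real t) = of_real (- (\<Sum>a\<in>A. t / (a - t)))"
    using assms by (subst euler_quot_eq) auto
  thus ?thesis by (simp only: Re_complex_of_real)
qed

text \<open>The bounds for a single \<open>w / (a - w)\<close> are summed over the zeros; the minus
  sign in front of the sum exchanges upper and lower bound.\<close>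

lemma Re_euler_quot_bounds:
  assumes "\<And>a. a \<in> A \<Longrightarrow> norm w < a"
  shows "Re (euler_quot P (of_real (norm w))) \<le> Re (euler_quot P w)"
    and "Re (euler_quot P w) \<le> Re (euler_quot P (of_real (- norm w)))"
proof -
  have "(\<Sum>a\<in>A. Re (w / (of_real a - w))) \<le> (\<Sum>a\<in>A. norm w / (a - norm w))"
    by (intro sum_mono Re_div_diff_le assms)
  moreover have "(\<Sum>a\<in>A. - norm w / (a + norm w)) \<le> (\<Sum>a\<in>A. Re (w / (of_real a - w)))"
    by (intro sum_mono Re_div_diff_ge assms)
  moreover have "Re (euler_quot P (of_real (norm w))) = - (\<Sum>a\<in>A. norm w / (a - norm w))"
    using assms by (intro euler_quot_of_real) auto
  moreover have "Re (euler_quot P (of_real (- norm w))) = - (\<Sum>a\<in>A. - norm w / (a - - norm w))"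
    using assms by (intro euler_quot_of_real) auto
  ultimately show "Re (euler_quot P (of_real (norm w))) \<le> Re (euler_quot P w)"
    "Re (euler_quot P w) \<le> Re (euler_quot P (of_real (- norm w)))"
    using euler_quot_eq[OF assms] by (simp_all del: Re_divide)
qed

lemma Re_deriv_0: "Re (deriv P 0) = - (\<Sum>a\<in>A. 1 / a)"
proof -
  have "deriv P 0 = of_real (- (\<Sum>a\<in>A. 1 / a))"
    using zeros_pos by (subst deriv_eq) (auto simp: P_def)
  thus ?thesis by (simp only: Re_complex_of_real)
qed

text \<open>Termwise \<open>t / (a - t) \<ge> t / a\<close>. The linear bound later forces the
  quotient below any prescribed level as long as no zero interferes.\<close>

lemma Re_euler_quot_le:
  assumes "0 \<le> t" "\<And>a. a \<in> A \<Longrightarrow> t < a"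
  shows "Re (euler_quot P (of_real t)) \<le> t * Re (deriv P 0)"
proof -
  have "t * (\<Sum>a\<in>A. 1 / a) \<le> (\<Sum>a\<in>A. t / (a - t))"
    unfolding sum_distrib_left using assms
    by (intro sum_mono) (force intro!: divide_left_mono mult_pos_pos)
  thus ?thesis
    using assms by (simp add: euler_quot_of_real Re_deriv_0)
qed

text \<open>Termwise, \<open>t / (a - t) = s / (1 - 2 s)\<close> with \<open>s = t / (a + t)\<close>, and no \<open>s\<close> exceeds the sum of all.\<close>
lemma Re_euler_quot_minus:
  assumes "0 \<le> t" "\<And>a. a \<in> A \<Longrightarrow> t < a"
    and half: "Re (euler_quot P (of_real (-t))) < 1 / 2"
  shows "- Re (euler_quot P (of_real t))
    \<le> Re (euler_quot P (of_real (-t))) / (1 - 2 * Re (euler_quot P (of_real (-t))))"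
proof -
  define S where "S = (\<Sum>a\<in>A. t / (a + t))"
  have S: "Re (euler_quot P (of_real (-t))) = S"
    using assms by (subst euler_quot_of_real) (auto simp: S_def sum_negf)
  have "(\<Sum>a\<in>A. t / (a - t)) \<le> (\<Sum>a\<in>A. t / (a + t) / (1 - 2 * S))"
  proof (rule sum_mono)
    fix a assume a: "a \<in> A"
    have ta: "t < a" using assms a by auto
    have le: "t / (a + t) \<le> S"
    proof -
      have "0 \<le> t / (b + t)" if "b \<in> A" for b
        using zeros_pos[OF that] assms(1) by simp
      thus ?thesis
        unfolding S_def using finite_zeros by (intro member_le_sum[OF a]) auto
    qed
    have "1 - 2 * (t / (a + t)) = (a - t) / (a + t)"
      using ta assms(1) by (simp add: field_simps)
    hence "t / (a - t) = t / (a + t) / (1 - 2 * (t / (a + t)))"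
      using ta assms(1) by simp
    also have "\<dots> \<le> t / (a + t) / (1 - 2 * S)"
      using le half S ta assms(1) by (intro divide_left_mono mult_pos_pos) auto
    finally show "t / (a - t) \<le> t / (a + t) / (1 - 2 * S)" .
  qed
  also have "\<dots> = S / (1 - 2 * S)"
    by (simp add: S_def sum_divide_distrib)
  finally show ?thesis
    using assms unfolding S by (subst euler_quot_of_real) auto
qed

end

section \<open>Passage to the limit\<close>

text \<open>
  \<open>H\<close> has genus 0 and positive zeros (Laguerre--P\'olya class), but only the approximation by
  finite products is used, never the zeros of \<open>H\<close> themselves.
\<close>
locale product_limit =
  fixes H :: "complex \<Rightarrow> complex" and A :: "nat \<Rightarrow> real set"
  assumes fin: "finite (A N)" and pos: "a \<in> A N \<Longrightarrow> 0 < a"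
    and ulim: "uniform_limit (cball 0 R) (\<lambda>N w. \<Prod>a\<in>A N. 1 - w / of_real a) H sequentially"
    and deriv_nz: "deriv H 0 \<noteq> 0"
begin

definition P :: "nat \<Rightarrow> complex \<Rightarrow> complex" where
  "P N = (\<lambda>w. \<Prod>a\<in>A N. 1 - w / of_real a)"

sublocale P: finite_product "A N" "P N" for N
  by unfold_locales (use fin pos in \<open>auto simp: P_def\<close>)

text \<open>\<open>H\<close> is real on the real axis, as \<open>H_of_real\<close> shows, so
  \<open>h\<close> and \<open>h'\<close> carry all its information there and admit intermediate
  value arguments.\<close>

definition h :: "real \<Rightarrow> real" where "h t = Re (H (of_real t))"
definition h' :: "real \<Rightarrow> real" where "h' t = Re (deriv H (of_real t))"
text \<open>Since \<open>h 0 = 1\<close>, this expresses that no zero has been met on the positive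
  axis up to \<open>r\<close>. By \<open>H_nonzero'\<close> the closed disc of radius
  \<open>r\<close> is then free of zeros.\<close>

definition pos_upto :: "real \<Rightarrow> bool" where "pos_upto r \<longleftrightarrow> (\<forall>t\<in>{0..r}. h t > 0)"

lemma ulim': "uniform_limit (cball 0 R) P H sequentially"
  using ulim[of R] by (simp add: P_def[abs_def])

lemma tendsto_H: "(\<lambda>N. P N w) \<longlonglongrightarrow> H w"
  by (rule tendsto_uniform_limitI[OF ulim'[of "norm w"]]) auto

lemma holo: "H holomorphic_on X"
proof -
  have "H holomorphic_on UNIV"
  proof (rule holomorphic_uniform_sequence[where f = P])
    fix x :: complex
    show "\<exists>d>0. cball x d \<subseteq> UNIV \<and> uniform_limit (cball x d) P H sequentially"
      by (intro exI[of _ 1] conjI uniform_limit_on_subset[OF ulim'[of "norm x + 1"]])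
        (auto simp: dist_norm norm_minus_commute, metis add.commute diff_add_cancel norm_minus_commute norm_triangle_le order.refl add_left_mono)
  qed (auto intro: P.holomorphic)
  thus ?thesis by (rule holomorphic_on_subset) auto
qed

lemma tendsto_deriv_H: "(\<lambda>N. deriv (P N) w) \<longlonglongrightarrow> deriv H w"
proof (rule deriv_complex_uniform_limit)
  show "uniform_limit (ball 0 (norm w + 1)) P H sequentially"
    by (rule uniform_limit_on_subset[OF ulim'[of "norm w + 1"]]) auto
qed (auto intro: P.holomorphic always_eventually)

lemma tendsto_euler_quot: "H w \<noteq> 0 \<Longrightarrow> (\<lambda>N. euler_quot (P N) w) \<longlonglongrightarrow> euler_quot H w"
  unfolding euler_quot_def by (intro tendsto_intros tendsto_H tendsto_deriv_H)

lemma H_field_deriv: "(H has_field_derivative deriv H w) (at w)"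
  by (rule holomorphic_derivI[OF holo[of UNIV]]) auto

lemma H_0: "H 0 = 1"
  using tendsto_H[of 0] by (simp add: P_def LIMSEQ_const_iff)

lemma H_of_real: "H (of_real t) = of_real (h t)"
proof -
  have "(\<lambda>N. Im (P N (of_real t))) \<longlonglongrightarrow> Im (H (of_real t))"
    by (intro tendsto_intros tendsto_H)
  hence "Im (H (of_real t)) = 0"
    by (simp only: P.eval_of_real Im_complex_of_real LIMSEQ_const_iff)
  thus ?thesis by (simp add: h_def complex_eq_iff)
qed

lemma H_vector_deriv: "((\<lambda>t. H (of_real t)) has_vector_derivative deriv H (of_real t)) (at t)"
  by (rule has_vector_derivative_real_field[OF H_field_deriv])

lemma h_deriv: "(h has_real_derivative h' t) (at t)"
  using has_derivative_Re[OF H_vector_deriv[unfolded has_vector_derivative_def]]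
  by (simp add: h_def[abs_def] h'_def has_field_derivative_def mult_commute_abs)

lemma deriv_H_of_real: "deriv H (of_real t) = of_real (h' t)"
proof -
  have "((\<lambda>t. Im (H (of_real t))) has_real_derivative Im (deriv H (of_real t))) (at t)"
    using has_derivative_Im[OF H_vector_deriv[unfolded has_vector_derivative_def]]
    by (simp add: has_field_derivative_def mult_commute_abs)
  moreover have "((\<lambda>t. Im (H (of_real t))) has_real_derivative 0) (at t)"
    by (simp add: H_of_real)
  ultimately have "Im (deriv H (of_real t)) = 0"
    by (rule DERIV_unique)
  thus ?thesis by (simp add: h'_def complex_eq_iff)
qed

lemma euler_quot_of_real: "euler_quot H (of_real t) = of_real (t * h' t / h t)"
  by (simp add: euler_quot_def H_of_real deriv_H_of_real)

lemma h_0: "h 0 = 1"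
  using H_0 by (simp add: h_def)

text \<open>The finite products have derivative \<open>- \<Sum> 1/a\<close> at 0, so the limit is at
  most 0; \<open>deriv_nz\<close> makes it strict.\<close>

lemma h'_0: "h' 0 < 0"
proof -
  have "(\<lambda>N. Re (deriv (P N) 0)) \<longlonglongrightarrow> Re (deriv H 0)"
    by (intro tendsto_intros tendsto_deriv_H)
  moreover have "Re (deriv (P N) 0) \<le> 0" for N
    using pos[of _ N] by (simp add: P.Re_deriv_0 sum_nonneg less_imp_le)
  ultimately have "Re (deriv H 0) \<le> 0"
    by (intro LIMSEQ_le_const2) auto
  moreover have "h' 0 \<noteq> 0"
    using deriv_H_of_real[of 0] deriv_nz by auto
  ultimately show ?thesis by (simp add: h'_def)
qed

lemma continuous_on_h [continuous_intros]: "continuous_on X h"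
  by (meson h_deriv DERIV_isCont continuous_at_imp_continuous_on)

lemma continuous_on_h' [continuous_intros]: "continuous_on X h'"
  unfolding h'_def
  by (intro continuous_intros continuous_on_compose2[OF holomorphic_on_imp_continuous_on[of "deriv H" UNIV]]
        holomorphic_deriv holo) auto

text \<open>A real counterpart of Hurwitz's theorem. All zeros of \<open>P N\<close> are positive,
  so only the interval matters; there \<open>h\<close> has a positive minimum, and an approximation
  closer than this minimum cannot vanish.\<close>

lemma zeros_eventually_gt:
  assumes "pos_upto r" "0 \<le> r"
  shows "eventually (\<lambda>N. \<forall>a\<in>A N. r < a) sequentially"
proof -
  have "\<exists>t0\<in>{0..r}. \<forall>t\<in>{0..r}. h t0 \<le> h t"
    using assms by (intro continuous_attains_inf continuous_on_h) auto
  then obtain t0 where t0: "t0 \<in> {0..r}" "\<forall>t\<in>{0..r}. h t0 \<le> h t" by blast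
  hence "h t0 > 0" using assms by (auto simp: pos_upto_def)
  from uniform_limitD[OF ulim'[of r] this]
  show ?thesis
  proof eventually_elim
    case (elim N)
    show ?case
    proof (rule ballI, rule ccontr)
      fix a assume a: "a \<in> A N" "\<not> r < a"
      hence a': "a \<in> {0..r}" using pos by force
      hence "dist (P N (of_real a)) (H (of_real a)) < h t0"
        using elim by auto
      hence "\<bar>h a\<bar> < h t0" using P.eq_0[OF a(1)] by (simp add: H_of_real dist_norm)
      thus False using t0 a' by force
    qed
  qed
qed

lemma norm_H_ge:
  assumes "pos_upto (norm w)"
  shows "h (norm w) \<le> norm (H w)"
proof (rule LIMSEQ_le)
  show "(\<lambda>N. norm (P N w)) \<longlonglongrightarrow> norm (H w)"
    by (intro tendsto_intros tendsto_H)
  show "(\<lambda>N. Re (P N (of_real (norm w)))) \<longlonglongrightarrow> h (norm w)"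
    unfolding h_def by (intro tendsto_intros tendsto_H)
  show "\<exists>N. \<forall>n\<ge>N. Re (P n (of_real (norm w))) \<le> norm (P n w)"
    using zeros_eventually_gt[OF assms]
    by (auto simp: eventually_sequentially intro!: P.norm_ge)
qed

lemma H_nonzero:
  assumes "pos_upto (norm w)"
  shows "H w \<noteq> 0"
proof -
  have "0 < h (norm w)"
    using assms by (auto simp: pos_upto_def)
  thus ?thesis using norm_H_ge[OF assms] by auto
qed

lemma H_nonzero': "norm w \<le> r \<Longrightarrow> pos_upto r \<Longrightarrow> H w \<noteq> 0"
  by (rule H_nonzero) (auto simp: pos_upto_def)

lemma tendsto_Re_euler_quot:
  "pos_upto (norm w) \<Longrightarrow> (\<lambda>N. Re (euler_quot (P N) w)) \<longlonglongrightarrow> Re (euler_quot H w)"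
  by (intro tendsto_intros tendsto_euler_quot H_nonzero)

lemma Re_euler_quot_bounds:
  assumes "pos_upto (norm w)"
  shows "Re (euler_quot H (of_real (norm w))) \<le> Re (euler_quot H w)" (is ?A)
    and "Re (euler_quot H w) \<le> Re (euler_quot H (of_real (- norm w)))" (is ?B)
proof -
  note ev = zeros_eventually_gt[OF assms norm_ge_zero]
  note lim = tendsto_Re_euler_quot
  show ?A
    using assms ev
    by (intro LIMSEQ_le[OF lim lim]) (auto simp: eventually_sequentially intro!: P.Re_euler_quot_bounds)
  show ?B
    using assms ev
    by (intro LIMSEQ_le[OF lim lim]) (auto simp: eventually_sequentially intro!: P.Re_euler_quot_bounds
       simp del: of_real_minus)
qed

lemma Re_euler_quot_le:
  assumes "pos_upto t" "0 \<le> t"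
  shows "Re (euler_quot H (of_real t)) \<le> t * h' 0"
proof (rule LIMSEQ_le)
  show "(\<lambda>N. Re (euler_quot (P N) (of_real t))) \<longlonglongrightarrow> Re (euler_quot H (of_real t))"
    using assms by (intro tendsto_Re_euler_quot) auto
  have "(\<lambda>N. t * Re (deriv (P N) (of_real 0))) \<longlonglongrightarrow> t * h' 0"
    unfolding h'_def by (intro tendsto_intros tendsto_deriv_H)
  thus "(\<lambda>N. t * Re (deriv (P N) 0)) \<longlonglongrightarrow> t * h' 0" by simp
  show "\<exists>N. \<forall>n\<ge>N. Re (euler_quot (P n) (of_real t)) \<le> t * Re (deriv (P n) 0)"
    using zeros_eventually_gt[OF assms] assms(2)
    by (auto simp: eventually_sequentially intro!: P.Re_euler_quot_le)
qed

text \<open>The strict bound by \<open>1/2\<close> passes from the limit to almost all finite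
  products, so their estimate applies and can be taken to the limit.\<close>

lemma Re_euler_quot_minus:
  assumes "pos_upto t" "0 \<le> t" and e: "Re (euler_quot H (of_real (-t))) \<le> e" "e < 1 / 2"
  shows "- Re (euler_quot H (of_real t)) \<le> e / (1 - 2 * e)"
proof -
  define S where "S = Re (euler_quot H (of_real (-t)))"
  have lim: "(\<lambda>N. Re (euler_quot (P N) (of_real t))) \<longlonglongrightarrow> Re (euler_quot H (of_real t))"
     "(\<lambda>N. Re (euler_quot (P N) (of_real (-t)))) \<longlonglongrightarrow> S"
    unfolding S_def using assms(1,2) by (intro tendsto_Re_euler_quot; simp)+
  have "S \<le> e" "S < 1 / 2" using e by (simp_all add: S_def)
  have "eventually (\<lambda>N. - Re (euler_quot (P N) (of_real t))
    \<le> Re (euler_quot (P N) (of_real (-t))) / (1 - 2 * Re (euler_quot (P N) (of_real (-t))))) sequentially"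
    using zeros_eventually_gt[OF assms(1,2)] order_tendstoD(2)[OF lim(2) \<open>S < 1 / 2\<close>]
    by eventually_elim (use assms in \<open>auto intro!: P.Re_euler_quot_minus simp del: of_real_minus\<close>)
  moreover have "(\<lambda>N. Re (euler_quot (P N) (of_real (-t))) / (1 - 2 * Re (euler_quot (P N) (of_real (-t)))))
      \<longlonglongrightarrow> S / (1 - 2 * S)"
    using \<open>S < 1 / 2\<close> by (intro tendsto_intros lim) auto
  ultimately have "- Re (euler_quot H (of_real t)) \<le> S / (1 - 2 * S)"
    by (intro tendsto_le[OF _ _ tendsto_minus[OF lim(1)]]) auto
  \<comment> \<open>The function \<open>s / (1 - 2 s)\<close> is increasing for
    \<open>s < 1/2\<close>.\<close>
  also have "\<dots> \<le> e / (1 - 2 * e)"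
    using \<open>S \<le> e\<close> \<open>S < 1 / 2\<close> e(2) by (simp add: field_simps)
  finally show ?thesis .
qed


section \<open>First point with a prescribed quotient\<close>

text \<open>
  If \<open>t h' + M h\<close> stayed positive, then \<open>t\<^sup>M h\<close> would increase, so \<open>h\<close> could not have a positive zero;
  but then \<open>t h' / h \<le> t h'(0)\<close> tends to \<open>-\<infinity>\<close>.
\<close>
lemma exists_euler_quot_le:
  assumes "M > 0"
  shows "\<exists>r>0. pos_upto r \<and> r * h' r + M * h r \<le> 0"
proof (rule ccontr)
  assume "\<not> ?thesis"
  hence neg: "r * h' r + M * h r > 0" if "pos_upto r" "r > 0" for r
    using that by force
  \<comment> \<open>Chosen so that the linear bound \<open>T h'(0)\<close> equals
    \<open>- (M + 1)\<close>, which lies strictly below \<open>- M\<close>.\<close>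
  define T where "T = (M + 1) / (- h' 0)"
  have "T > 0" unfolding T_def using h'_0 assms by (intro divide_pos_pos) auto
  show False
  proof (cases "pos_upto T")
    case True
    hence "h T > 0" using \<open>T > 0\<close> by (auto simp: pos_upto_def)
    have "Re (euler_quot H (of_real T)) \<le> T * h' 0"
      using True \<open>T > 0\<close> by (intro Re_euler_quot_le) auto
    also have "T * h' 0 = - (M + 1)" using h'_0 by (simp add: T_def field_simps)
    finally have "T * h' T / h T < - M"
      unfolding euler_quot_of_real by simp
    thus False using neg[OF True \<open>T > 0\<close>] \<open>h T > 0\<close> by (simp add: field_simps)
  next
    case False
    then obtain b where b: "0 \<le> b" "b \<le> T" "h b \<le> 0"
      by (force simp: pos_upto_def)
    then obtain s where s: "s > 0" "h s = 0" "\<forall>u\<in>{0..<s}. h u > 0"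
      using first_zero[of b h] h_0 by (auto intro: continuous_on_h)
    define k where "k t = t powr M * h t" for t
    \<comment> \<open>Monotonicity from \<open>s / 2\<close> to \<open>s\<close> is absurd, because
      \<open>k\<close> is positive at the left end and 0 at the right end.\<close>
    have "k (s / 2) \<le> k s"
    proof (rule DERIV_nonneg_imp_increasing_open[of "s / 2" s k])
      fix x assume x: "s / 2 < x" "x < s"
      hence "x > 0" using s by simp
      have "(k has_real_derivative M * x powr (M - 1) * h x + x powr M * h' x) (at x)"
        unfolding k_def using \<open>x > 0\<close> by (auto intro!: derivative_eq_intros h_deriv)
      moreover have "M * x powr (M - 1) * h x + x powr M * h' x = x powr (M - 1) * (x * h' x + M * h x)"
        using \<open>x > 0\<close> by (simp add: powr_diff field_simps)
      moreover have "0 \<le> x * h' x + M * h x"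
        using neg[of x] x s \<open>x > 0\<close> by (auto simp: pos_upto_def intro!: less_imp_le)
      ultimately show "\<exists>y. (k has_real_derivative y) (at x) \<and> 0 \<le> y"
        by (metis mult_nonneg_nonneg powr_ge_zero)
    next
      show "continuous_on {s / 2..s} k"
        unfolding k_def using s by (intro continuous_intros) auto
    qed (use s in auto)
    moreover have "k (s / 2) > 0"
    proof -
      have "h (s / 2) > 0" using s by auto
      thus ?thesis using s unfolding k_def by (intro mult_pos_pos) auto
    qed
    moreover have "k s = 0" using s by (simp add: k_def)
    ultimately show False by linarith
  qed
qed

text \<open>Apply \<open>first_zero\<close> to \<open>u h'(u) + M h(u)\<close>, which is
  \<open>M > 0\<close> at the origin. Up to the point found, \<open>h\<close> is positive, so the
  sign conditions may be divided by it.\<close>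

lemma exists_euler_quot_eq:
  assumes "M > 0"
  shows "\<exists>r>0. pos_upto r \<and> euler_quot H (of_real r) = of_real (-M) \<and>
           (\<forall>t\<in>{0..<r}. Re (euler_quot H (of_real t)) > - M)"
proof -
  obtain b where b: "b > 0" "pos_upto b" "b * h' b + M * h b \<le> 0"
    using exists_euler_quot_le[OF assms] by blast
  have "\<exists>s>0. s \<le> b \<and> s * h' s + M * h s = 0 \<and> (\<forall>u\<in>{0..<s}. u * h' u + M * h u > 0)"
    using b assms h_0 by (intro first_zero continuous_intros) auto
  then obtain s where s: "s > 0" "s \<le> b" "s * h' s + M * h s = 0" "\<forall>u\<in>{0..<s}. u * h' u + M * h u > 0"
    by blast
  have h: "h u > 0" if "u \<in> {0..s}" for u
    using that b s by (auto simp: pos_upto_def)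
  have "s * h' s / h s = - M"
    using s h[of s] by (auto simp: field_simps)
  moreover have "u * h' u / h u > - M" if "u \<in> {0..<s}" for u
  proof -
    have "u * h' u + M * h u > 0" "h u > 0"
      using s that h[of u] by auto
    thus ?thesis by (simp add: less_divide_eq)
  qed
  ultimately show ?thesis
    using s h unfolding euler_quot_of_real
    by (intro exI[of _ s]) (auto simp: pos_upto_def simp del: of_real_divide of_real_mult)
qed

text \<open>The level \<open>e\<close> has to be reached on the negative axis while the disc is
  still free of zeros. If it were not reached up to \<open>b\<close>, the quotient at
  \<open>b\<close> could not be as small as \<open>- M\<close>, by
  \<open>Re_euler_quot_minus\<close>.\<close>

lemma exists_euler_quot_minus_eq:
  assumes "0 < e" "e < 1 / 2"
  shows "\<exists>r>0. pos_upto r \<and> euler_quot H (of_real (-r)) = of_real e \<and>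
           (\<forall>t\<in>{0..<r}. Re (euler_quot H (of_real (-t))) < e)"
proof -
  \<comment> \<open>Any value exceeding \<open>e / (1 - 2 e)\<close>, the bound supplied by
    \<open>Re_euler_quot_minus\<close>.\<close>
  define M where "M = e / (1 - 2 * e) + 1"
  have "M > 0" using assms by (auto simp: M_def intro!: add_nonneg_pos)
  then obtain b where b: "b > 0" "pos_upto b" "euler_quot H (of_real b) = of_real (-M)"
    using exists_euler_quot_eq by blast
  define g where "g t = e - Re (euler_quot H (of_real (-t)))" for t
  have g: "g t = e - (- t * h' (-t) / h (-t))" for t
    unfolding g_def euler_quot_of_real by simp
  have nz: "h (-t) \<noteq> 0" if "t \<in> {0..b}" for t
    using H_nonzero'[of "of_real (-t)" b] that b unfolding H_of_real by auto
  have "g b \<le> 0"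
  proof (rule ccontr)
    assume "\<not> g b \<le> 0"
    hence "- Re (euler_quot H (of_real b)) \<le> e / (1 - 2 * e)"
      using assms b by (intro Re_euler_quot_minus) (auto simp: g_def)
    thus False unfolding b by (simp add: M_def)
  qed
  moreover have "continuous_on {0..b} g"
    unfolding g using nz
    by (intro continuous_intros continuous_on_compose2[OF continuous_on_h[of UNIV]]
          continuous_on_compose2[OF continuous_on_h'[of UNIV]]) auto
  moreover have "g 0 > 0" using assms by (simp add: g)
  ultimately have "\<exists>s>0. s \<le> b \<and> g s = 0 \<and> (\<forall>u\<in>{0..<s}. g u > 0)"
    using b by (intro first_zero) auto
  then obtain s where s: "s > 0" "s \<le> b" "g s = 0" "\<forall>u\<in>{0..<s}. g u > 0" by blast
  have "pos_upto s" using b s by (auto simp: pos_upto_def)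
  moreover have "euler_quot H (of_real (-s)) = of_real (Re (euler_quot H (of_real (-s))))"
    unfolding euler_quot_of_real by (simp only: Re_complex_of_real)
  hence "euler_quot H (of_real (-s)) = of_real e"
    using s(3) by (simp add: g_def)
  ultimately show ?thesis
    using s by (intro exI[of _ s]) (auto simp: g_def)
qed

end

section \<open>Radius of starlikeness\<close>

lemma euler_quot_cong:
  assumes "eventually (\<lambda>w. f w = g w) (nhds z)"
  shows "euler_quot f z = euler_quot g z"
  using deriv_cong_ev[OF assms refl] eventually_nhds_x_imp_x[OF assms]
  by (simp add: euler_quot_def)

lemma tendsto_euler_quot:
  assumes "f holomorphic_on S" "open S" "z \<in> S" "f z \<noteq> 0" "(g \<longlongrightarrow> z) F"
  shows "((\<lambda>t. euler_quot f (g t)) \<longlongrightarrow> euler_quot f z) F"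
proof -
  have "isCont f z" "isCont (deriv f) z"
    using assms holomorphic_deriv[of f S] holomorphic_on_imp_continuous_on
    by (metis continuous_on_eq_continuous_at)+
  hence "((\<lambda>t. f (g t)) \<longlongrightarrow> f z) F" "((\<lambda>t. deriv f (g t)) \<longlongrightarrow> deriv f z) F"
    using assms(5) by (auto intro: isCont_tendsto_compose)
  thus ?thesis
    unfolding euler_quot_def using assms by (intro tendsto_divide tendsto_mult) auto
qed

text \<open>If a radius beyond \<open>x\<close> were admissible, the power series would be
  holomorphic and nonzero at \<open>x u\<close>, so its quotient would be continuous there and take
  the value \<beta>, against the strict inequality. Approaching the boundary point from inside
  suffices, as \<open>F\<close> is controlled only in the open disc.\<close>

lemma starlikeness_radius_eqI:
  assumes "x > 0" and holo: "F holomorphic_on ball 0 x"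
    and germ: "eventually (\<lambda>z. f z = F z) (nhds 0)"
    and inside: "\<And>z. z \<in> ball 0 x \<Longrightarrow> z \<noteq> 0 \<Longrightarrow> F z \<noteq> 0 \<and> \<beta> < Re (euler_quot F z)"
    and u: "norm u = 1"
    and boundary: "((\<lambda>t. Re (euler_quot F (of_real t * u))) \<longlongrightarrow> \<beta>) (at_left x)"
  shows "starlikeness_radius \<beta> f = ereal x"
proof -
  define p where "p = fps_expansion f 0"
  have p: "p = fps_expansion F 0"
    unfolding p_def by (rule fps_expansion_cong[OF germ])
  have eball: "eball 0 (ereal x) = (ball 0 x :: complex set)" by auto
  have rad: "fps_conv_radius p \<ge> ereal x"
    unfolding p using holo by (intro conv_radius_fps_expansion) (simp add: eball)
  have eval: "eval_fps p z = F z" if "z \<in> ball 0 x" for z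
    unfolding p using eval_fps_expansion'[of F 0 "ereal x" z] holo that by (simp add: eball)
  have quot: "euler_quot (eval_fps p) z = euler_quot F z" if "z \<in> ball 0 x" for z
    using eventually_nhds_in_open[OF open_ball that]
    by (intro euler_quot_cong) (auto elim!: eventually_mono simp: eval)
  define R where "R = {ereal r | r. 0 < r \<and> ereal r < fps_conv_radius p \<and>
       (\<forall>z\<in>ball 0 r. z \<noteq> 0 \<longrightarrow> eval_fps p z \<noteq> 0 \<and> \<beta> < Re (euler_quot (eval_fps p) z))}"
  have "starlikeness_radius \<beta> f = Sup R"
    unfolding starlikeness_radius_def R_def p_def euler_quot_def Let_def by (rule refl)
  moreover have "Sup R \<le> ereal x"
  proof (rule Sup_least)
    fix y assume "y \<in> R"
    then obtain r where r: "y = ereal r" "0 < r" "ereal r < fps_conv_radius p"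
      "\<And>z. z \<in> ball 0 r \<Longrightarrow> z \<noteq> 0 \<Longrightarrow> eval_fps p z \<noteq> 0 \<and> \<beta> < Re (euler_quot (eval_fps p) z)"
      by (auto simp: R_def)
    have "r \<le> x"
    proof (rule ccontr)
      assume "\<not> r \<le> x"
      define q where "q = of_real x * u"
      have q: "q \<in> ball 0 r" "q \<noteq> 0"
        using u \<open>x > 0\<close> \<open>\<not> r \<le> x\<close> by (auto simp: q_def norm_mult)
      have "ball 0 r \<subseteq> eball (0::complex) (fps_conv_radius p)"
        using r(3) by (intro ball_eball_mono less_imp_le)
      hence "eval_fps p holomorphic_on ball 0 r"
        by (rule holomorphic_on_eval_fps)
      hence "((\<lambda>t. euler_quot (eval_fps p) (of_real t * u)) \<longlongrightarrow> euler_quot (eval_fps p) q) (at_left x)"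
        using q r(4)[OF q] by (intro tendsto_euler_quot) (auto simp: q_def intro!: tendsto_intros)
      hence "((\<lambda>t. Re (euler_quot (eval_fps p) (of_real t * u))) \<longlongrightarrow> Re (euler_quot (eval_fps p) q)) (at_left x)"
        by (rule tendsto_Re)
      moreover have "eventually (\<lambda>t. t \<in> {0<..<x}) (at_left x)"
        using \<open>x > 0\<close> by (rule eventually_at_left_real)
      hence "eventually (\<lambda>t. Re (euler_quot F (of_real t * u))
          = Re (euler_quot (eval_fps p) (of_real t * u))) (at_left x)"
        by eventually_elim (use u in \<open>simp add: quot norm_mult\<close>)
      with boundary have "((\<lambda>t. Re (euler_quot (eval_fps p) (of_real t * u))) \<longlongrightarrow> \<beta>) (at_left x)"
        by (rule Lim_transform_eventually)
      ultimately have "Re (euler_quot (eval_fps p) q) = \<beta>"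
        by (rule tendsto_unique[rotated]) simp
      thus False using r(4)[OF q] by simp
    qed
    thus "y \<le> ereal x" using r by simp
  qed
  moreover have "ereal x \<le> Sup R"
    unfolding le_Sup_iff
  proof (intro allI impI)
    fix y assume "y < ereal x"
    then obtain r where r: "y < ereal r" "ereal r < ereal x"
      using ereal_dense2 by blast
    \<comment> \<open>The number \<open>r\<close> may fail to be positive; comparison with
      \<open>x / 2\<close> repairs this.\<close>
    define r' where "r' = max r (x / 2)"
    have "y < ereal r'"
      using r(1) by (rule order.strict_trans2) (simp add: r'_def)
    hence r': "y < ereal r'" "0 < r'" "r' < x"
      using r \<open>x > 0\<close> by (auto simp: r'_def)
    hence "ereal r' < fps_conv_radius p"
      using rad by (metis ereal_less_eq(3) less_ereal.simps(1) order_less_le_trans)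
    hence "ereal r' \<in> R"
      unfolding R_def using r' inside by (auto simp: eval quot intro!: exI[of _ r'])
    thus "\<exists>a\<in>R. y < a" using r' by blast
  qed
  ultimately show ?thesis by simp
qed

text \<open>The quotient for \<open>z H(z^k)^c\<close> is \<open>1 + k c \<phi>(z^k)\<close>, with
  \<open>\<phi>\<close> the quotient of \<open>H\<close>. The unit vector \<open>u\<close> is the
  direction in which the condition first fails, and \<open>z = x u\<close> corresponds to
  \<open>w = s x^k\<close>.\<close>

lemma starlikeness_radius_powr:
  fixes k :: nat and c x s :: real and u :: complex
  assumes holo: "H holomorphic_on UNIV" and "H 0 = 1" and "k > 0" "x > 0"
    and nz: "\<And>w. norm w < x ^ k \<Longrightarrow> H w \<noteq> 0"
    and inside: "\<And>w. norm w < x ^ k \<Longrightarrow> \<beta> < 1 + real k * c * Re (euler_quot H w)"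
    and u: "norm u = 1" "u ^ k = of_real s"
    and bd_nz: "H (of_real (s * x ^ k)) \<noteq> 0"
    and bd: "1 + real k * c * Re (euler_quot H (of_real (s * x ^ k))) = \<beta>"
    and f: "\<And>z. f z = z * H (z ^ k) powr of_real c"
  shows "starlikeness_radius \<beta> f = ereal x"
proof -
  define B where "B = ball (0::complex) (x ^ k)"
  have "0 \<in> B" using \<open>x > 0\<close> by (simp add: B_def)
  obtain L0 where L0: "L0 holomorphic_on B" "\<And>w. w \<in> B \<Longrightarrow> exp (L0 w) = H w"
    using holomorphic_logarithm_exists[of B H 0] nz \<open>0 \<in> B\<close> holomorphic_on_subset[OF holo]
    by (auto simp: B_def)
  \<comment> \<open>Subtracting \<open>L0 0\<close> normalizes the logarithm to 0 at the origin; it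
    is still a logarithm of \<open>H\<close> because \<open>exp (L0 0) = H 0 = 1\<close>.\<close>
  define L where "L w = L0 w - L0 0" for w
  have L: "L holomorphic_on B" "exp (L w) = H w" if "w \<in> B" for w
    using L0(1) L0(2)[OF that] L0(2)[OF \<open>0 \<in> B\<close>] \<open>H 0 = 1\<close>
    by (auto simp: L_def[abs_def] exp_diff intro!: holomorphic_intros)
  have holL: "L holomorphic_on B" using L \<open>0 \<in> B\<close> by blast
  have dL: "(L has_field_derivative deriv H w / H w) (at w)" if "w \<in> B" for w
  proof -
    have d: "(L has_field_derivative deriv L w) (at w)"
      by (rule holomorphic_derivI[OF holL]) (use that in \<open>auto simp: B_def\<close>)
    have "((\<lambda>w. exp (L w)) has_field_derivative exp (L w) * deriv L w) (at w)"
      using d by (auto intro!: derivative_eq_intros)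
    hence "deriv (\<lambda>w. exp (L w)) w = exp (L w) * deriv L w"
      by (rule DERIV_imp_deriv)
    moreover have "deriv (\<lambda>w. exp (L w)) w = deriv H w"
      using that by (intro deriv_cong_ev eventually_mono[OF eventually_nhds_in_open[of B]])
        (auto simp: L B_def)
    ultimately show ?thesis using d L(2)[OF that] exp_not_eq_zero[of "L w"] by (simp add: field_simps)
  qed
  have pow: "z ^ k \<in> B" if "z \<in> ball 0 x" for z
    using that \<open>k > 0\<close> by (auto simp: B_def norm_power intro!: power_strict_mono)
  \<comment> \<open>continues the germ of \<open>f\<close> to points where \<open>H\<close> crosses the cut of the principal power\<close>
  define F where "F z = z * exp (of_real c * L (z ^ k))" for z
  have dF: "(F has_field_derivative exp (of_real c * L (z ^ k))
      * (1 + of_real (real k * c) * euler_quot H (z ^ k))) (at z)" if "z \<in> ball 0 x" for z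
  proof -
    have d: "((\<lambda>z. L (z ^ k)) has_field_derivative deriv H (z ^ k) / H (z ^ k) * (of_nat k * z ^ (k - 1))) (at z)"
      by (rule DERIV_chain2[where f = L and g = "\<lambda>z. z ^ k"], rule dL[OF pow[OF that]])
        (auto intro!: derivative_eq_intros)
    have "(F has_field_derivative exp (of_real c * L (z ^ k)) + z * (exp (of_real c * L (z ^ k))
        * (of_real c * (deriv H (z ^ k) / H (z ^ k) * (of_nat k * z ^ (k - 1)))))) (at z)"
      unfolding F_def by (auto intro!: derivative_eq_intros d)
    moreover have "z ^ k = z * z ^ (k - 1)"
      using \<open>k > 0\<close> by (simp add: power_eq_if)
    ultimately show ?thesis
      by (simp add: euler_quot_def algebra_simps)
  qed
  have holF: "F holomorphic_on ball 0 x"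
    using dF by (intro holomorphic_on_open[THEN iffD2]) blast+
  have quotF: "euler_quot F z = 1 + of_real (real k * c) * euler_quot H (z ^ k)"
    if "z \<in> ball 0 x" "z \<noteq> 0" for z
    using DERIV_imp_deriv[OF dF[OF that(1)]] that(2) unfolding euler_quot_def[of F]
    by (simp add: F_def)
  have ReF: "Re (euler_quot F z) = 1 + real k * c * Re (euler_quot H (z ^ k))"
    if "z \<in> ball 0 x" "z \<noteq> 0" for z
    unfolding quotF[OF that] by (simp only: plus_complex.sel one_complex.sel Re_complex_of_real times_complex.sel Im_complex_of_real)
  show ?thesis
  proof (rule starlikeness_radius_eqI[OF \<open>x > 0\<close> holF _ _ u(1)])
    have "isCont L 0"
      using holL \<open>0 \<in> B\<close> by (auto intro!: continuous_on_interior[of B] holomorphic_on_imp_continuous_on simp: B_def)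
    hence "((\<lambda>z. L (z ^ k)) \<longlongrightarrow> L 0) (nhds 0)"
      by (rule isCont_tendsto_compose) (use \<open>k > 0\<close> in \<open>auto intro!: tendsto_eq_intros filterlim_ident simp: zero_power\<close>)
    hence "((\<lambda>z. \<bar>Im (L (z ^ k))\<bar>) \<longlongrightarrow> \<bar>Im (L 0)\<bar>) (nhds 0)"
      by (intro tendsto_intros)
    \<comment> \<open>In this strip the principal logarithm inverts \<open>exp\<close>, so the
      principal power coincides with the branch built from \<open>L\<close> near 0.\<close>
    hence "eventually (\<lambda>z. \<bar>Im (L (z ^ k))\<bar> < pi) (nhds 0)"
      by (rule order_tendstoD) (simp add: L_def)
    moreover have "eventually (\<lambda>z. z \<in> ball 0 x) (nhds 0)"
      using \<open>x > 0\<close> by (intro eventually_nhds_in_open) auto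
    ultimately show "eventually (\<lambda>z. f z = F z) (nhds 0)"
    proof eventually_elim
      case (elim z)
      have "Ln (H (z ^ k)) = L (z ^ k)"
        using elim by (subst L(2)[OF pow, symmetric]) (auto intro!: Ln_exp simp: abs_less_iff)
      moreover have "H (z ^ k) \<noteq> 0"
        using pow[OF elim(2)] by (intro nz) (simp add: B_def)
      ultimately show ?case by (simp add: f F_def powr_def)
    qed
  next
    fix z :: complex assume z: "z \<in> ball 0 x" "z \<noteq> 0"
    show "F z \<noteq> 0 \<and> \<beta> < Re (euler_quot F z)"
      using z pow[OF z(1)] inside[of "z ^ k"] by (simp add: ReF F_def B_def)
  next
    have "((\<lambda>t. 1 + real k * c * Re (euler_quot H ((of_real t * u) ^ k))) \<longlongrightarrow>
        1 + real k * c * Re (euler_quot H (of_real (s * x ^ k)))) (at_left x)"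
      by (intro tendsto_intros tendsto_euler_quot[OF holo _ _ bd_nz])
        (auto simp: power_mult_distrib u intro!: tendsto_eq_intros)
    moreover have "eventually (\<lambda>t. t \<in> {0<..<x}) (at_left x)"
      using \<open>x > 0\<close> by (rule eventually_at_left_real)
    hence "eventually (\<lambda>t. 1 + real k * c * Re (euler_quot H ((of_real t * u) ^ k))
        = Re (euler_quot F (of_real t * u))) (at_left x)"
      by eventually_elim (use u in \<open>subst ReF; force simp: norm_mult\<close>)
    ultimately show "((\<lambda>t. Re (euler_quot F (of_real t * u))) \<longlongrightarrow> \<beta>) (at_left x)"
      unfolding bd by (rule Lim_transform_eventually)
  qed
qed

lemma smallest_positive_root_cong:
  assumes "\<And>r. r > 0 \<Longrightarrow> Q r \<longleftrightarrow> Q' r"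
  shows "smallest_positive_root Q x \<longleftrightarrow> smallest_positive_root Q' x"
  using assms unfolding smallest_positive_root_def by auto

section \<open>Radii for limits of products\<close>

context product_limit
begin

text \<open>For \<open>c > 0\<close> the condition bounds \<open>Re \<phi>\<close> from below by
  \<open>- M\<close>. On a circle the minimum is attained at the positive point, so failure first
  occurs in direction \<open>u = 1\<close>.\<close>

lemma starlikeness_radius_pos_exponent:
  fixes k :: nat and c :: real
  assumes "\<beta> < 1" "c > 0" "k > 0" and f: "\<And>z. f z = z * H (z ^ k) powr of_real c"
  shows "\<exists>x. smallest_positive_root (\<lambda>r. H (of_real (r ^ k)) \<noteq> 0 \<and>
                 euler_quot H (of_real (r ^ k)) = of_real (- ((1 - \<beta>) / (real k * c)))) x
             \<and> starlikeness_radius \<beta> f = ereal x"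
proof -
  define M where "M = (1 - \<beta>) / (real k * c)"
  have "M > 0" using assms by (auto simp: M_def)
  have M: "1 + real k * c * (- M) = \<beta>"
    using assms by (simp add: M_def)
  obtain r where r: "r > 0" "pos_upto r" "euler_quot H (of_real r) = of_real (-M)"
      "\<And>t. t \<in> {0..<r} \<Longrightarrow> Re (euler_quot H (of_real t)) > - M"
    using exists_euler_quot_eq[OF \<open>M > 0\<close>] by blast
  define x where "x = root k r"
  have x: "x > 0" "x ^ k = r"
    using r \<open>k > 0\<close> by (auto simp: x_def)
  have "starlikeness_radius \<beta> f = ereal x"
  proof (rule starlikeness_radius_powr[where H = H and k = k and c = c and u = 1 and s = 1])
    fix w :: complex assume w: "norm w < x ^ k"
    have pw: "pos_upto (norm w)" using w r x by (auto simp: pos_upto_def)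
    thus "H w \<noteq> 0" by (rule H_nonzero)
    have "- M < Re (euler_quot H (of_real (norm w)))"
      using w x by (intro r) auto
    also have "\<dots> \<le> Re (euler_quot H w)"
      by (rule Re_euler_quot_bounds[OF pw])
    finally have "real k * c * (- M) < real k * c * Re (euler_quot H w)"
      using assms by (intro mult_strict_left_mono) auto
    thus "\<beta> < 1 + real k * c * Re (euler_quot H w)"
      using M by linarith
  next
    show "1 + real k * c * Re (euler_quot H (of_real (1 * x ^ k))) = \<beta>"
      using M r(3) by (simp add: x)
    show "H (of_real (1 * x ^ k)) \<noteq> 0"
      using r(1,2) by (intro H_nonzero) (simp add: x)
  qed (use assms x holo H_0 in auto)
  moreover have "smallest_positive_root (\<lambda>r. H (of_real (r ^ k)) \<noteq> 0 \<and>
                 euler_quot H (of_real (r ^ k)) = of_real (- M)) x"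
    unfolding smallest_positive_root_def
  proof (intro conjI allI impI)
    show "H (of_real (x ^ k)) \<noteq> 0"
      using r(1,2) by (intro H_nonzero) (simp add: x)
    show "euler_quot H (of_real (x ^ k)) = of_real (- M)"
      unfolding x by (rule r(3))
    show "x \<le> t" if "0 < t \<and> H (of_real (t ^ k)) \<noteq> 0 \<and> euler_quot H (of_real (t ^ k)) = of_real (- M)" for t
    proof (rule ccontr)
      assume "\<not> x \<le> t"
      hence "t ^ k \<in> {0..<r}"
        using that \<open>k > 0\<close> x by (auto intro!: power_strict_mono simp flip: x(2))
      from r(4)[OF this] show False using that by simp
    qed
  qed (use x in auto)
  ultimately show ?thesis unfolding M_def by blast
qed

text \<open>A negative \<open>c\<close> turns the condition into the upper bound
  \<open>Re \<phi> < e\<close>. The maximum on a circle lies at \<open>w = - norm w\<close>, which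
  is reached by imaginary \<open>z\<close>; hence \<open>u = \<i>\<close> and
  \<open>s = -1\<close>.\<close>

lemma starlikeness_radius_neg_exponent:
  fixes c :: real
  assumes "0 \<le> \<beta>" "\<beta> < 1" "c < -1" and f: "\<And>z. f z = z * H (z ^ 2) powr of_real c"
  shows "\<exists>x. smallest_positive_root (\<lambda>r. H (of_real (- (r ^ 2))) \<noteq> 0 \<and>
                 euler_quot H (of_real (- (r ^ 2))) = of_real (- ((1 - \<beta>) / (2 * c)))) x
             \<and> starlikeness_radius \<beta> f = ereal x"
proof -
  define e where "e = - ((1 - \<beta>) / (2 * c))"
  have "e > 0" using assms by (auto simp: e_def divide_pos_neg)
  \<comment> \<open>Here \<open>c < -1\<close> enters together with \<open>\<beta> \<ge> 0\<close>:
    \<open>1 - \<beta> \<le> 1 < - c\<close>.\<close>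
  have "e < 1 / 2" using assms by (simp add: e_def field_simps)
  have e: "1 + 2 * c * e = \<beta>"
    using assms by (simp add: e_def)
  obtain r where r: "r > 0" "pos_upto r" "euler_quot H (of_real (-r)) = of_real e"
      "\<And>t. t \<in> {0..<r} \<Longrightarrow> Re (euler_quot H (of_real (-t))) < e"
    using exists_euler_quot_minus_eq[OF \<open>e > 0\<close> \<open>e < 1 / 2\<close>] by blast
  define x where "x = sqrt r"
  have x: "x > 0" "x ^ 2 = r"
    using r by (auto simp: x_def)
  have nz: "H (of_real (- r)) \<noteq> 0"
    using r(1,2) by (intro H_nonzero) simp
  have "starlikeness_radius \<beta> f = ereal x"
  proof (rule starlikeness_radius_powr[where H = H and k = 2 and c = c and u = \<i> and s = "-1"])
    fix w :: complex assume w: "norm w < x ^ 2"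
    have pw: "pos_upto (norm w)" using w r x by (auto simp: pos_upto_def)
    thus "H w \<noteq> 0" by (rule H_nonzero)
    have "Re (euler_quot H w) \<le> Re (euler_quot H (of_real (- norm w)))"
      by (rule Re_euler_quot_bounds[OF pw])
    also have "\<dots> < e"
      using w x by (intro r) auto
    finally have "2 * c * e < 2 * c * Re (euler_quot H w)"
      using assms by (intro mult_strict_left_mono_neg) auto
    thus "\<beta> < 1 + real 2 * c * Re (euler_quot H w)"
      using e by simp
  next
    show "1 + real 2 * c * Re (euler_quot H (of_real (-1 * x ^ 2))) = \<beta>"
      using e r(3) by (simp add: x)
    show "H (of_real (-1 * x ^ 2)) \<noteq> 0"
      using nz by (simp add: x)
  qed (use assms x holo H_0 in auto)
  moreover have "smallest_positive_root (\<lambda>r. H (of_real (- (r ^ 2))) \<noteq> 0 \<and>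
                 euler_quot H (of_real (- (r ^ 2))) = of_real e) x"
    unfolding smallest_positive_root_def
  proof (intro conjI allI impI)
    show "H (of_real (- (x ^ 2))) \<noteq> 0"
      unfolding x by (rule nz)
    show "euler_quot H (of_real (- (x ^ 2))) = of_real e"
      unfolding x by (rule r(3))
    show "x \<le> t" if "0 < t \<and> H (of_real (- (t ^ 2))) \<noteq> 0 \<and> euler_quot H (of_real (- (t ^ 2))) = of_real e" for t
    proof (rule ccontr)
      assume "\<not> x \<le> t"
      hence "t ^ 2 \<in> {0..<r}"
        using that x by (auto intro!: power_strict_mono simp flip: x(2))
      from r(4)[OF this] show False using that by simp
    qed
  qed (use x in auto)
  ultimately show ?thesis unfolding e_def by blast
qed

end

section \<open>Bessel functions\<close>

definition Bessel_H :: "real \<Rightarrow> nat \<Rightarrow> complex \<Rightarrow> complex" where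
  "Bessel_H \<nu> n w = of_real (Gamma (\<nu> - real n + 1)) * eval_fps (Bessel_fps \<nu> n) w"

text \<open>
  The factor \<open>4 k\<close> comes from the limit: the Laguerre polynomial of degree \<open>k\<close> at \<open>w / (4 k)\<close> tends to
  the Bessel series in \<open>w = z\<^sup>2\<close>.
\<close>
definition Bessel_poly_zeros :: "real \<Rightarrow> nat \<Rightarrow> nat \<Rightarrow> real set" where
  "Bessel_poly_zeros \<nu> n k = (*) (4 * real k) ` {x. 0 < x \<and> poly (Bessel_poly \<nu> n k) x = 0}"

text \<open>For \<open>k > 0\<close> this is \<open>k (k - 1) \<dots> (k - m + 1) / k^m\<close>, the
  factor separating the term number \<open>m\<close> of the rescaled polynomial from that of the
  Bessel series.\<close>

definition falling_ratio :: "nat \<Rightarrow> nat \<Rightarrow> real" where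
  "falling_ratio k m = fact m * real (k choose m) / real k ^ m"

lemma falling_ratio_bounds: "0 \<le> falling_ratio k m" "falling_ratio k m \<le> 1"
proof -
  have "(k choose m) * fact m \<le> k ^ m"
    by (rule binomial_fact_pow)
  hence "real (k choose m) * fact m \<le> real k ^ m"
    by (metis of_nat_fact of_nat_le_iff of_nat_mult of_nat_power)
  thus "falling_ratio k m \<le> 1"
    by (cases "real k ^ m = 0") (auto simp: falling_ratio_def divide_le_eq mult.commute)
qed (auto simp: falling_ratio_def)

lemma falling_ratio_tendsto: "(\<lambda>k. falling_ratio k m) \<longlonglongrightarrow> 1"
proof -
  have "(\<lambda>k. \<Prod>i<m. (real k - real i) / real k) \<longlonglongrightarrow> (\<Prod>i<m. 1)"
  proof (rule tendsto_prod)
    fix i show "(\<lambda>k. (real k - real i) / real k) \<longlonglongrightarrow> 1" by real_asymp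
  qed
  moreover have "(\<Prod>i<m. (real k - real i) / real k) = falling_ratio k m" for k
    unfolding falling_ratio_def binomial_gbinomial gbinomial_prod_rev
    by (simp add: prod_dividef atLeast0LessThan)
  ultimately show ?thesis by simp
qed

lemma Bessel_fps_nth_0:
  assumes "\<nu> > real n - 1"
  shows "fps_nth (Bessel_fps \<nu> n) 0 = of_real (1 / Gamma (\<nu> - real n + 1))"
proof -
  have "Gamma (\<nu> + 1) > 0"
    using assms by (intro Gamma_real_pos) auto
  thus ?thesis
    by (simp add: Bessel_fps_def rGamma_inverse_Gamma add_ac divide_inverse)
qed

lemma poly_map_poly_of_real:
  "poly (map_poly of_real p) (of_real x :: 'a :: {real_algebra_1, comm_semiring_1}) = of_real (poly p x)"
  by (induction p) (auto simp: map_poly_pCons)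

text \<open>The product is the normalized polynomial at \<open>w / (4 k)\<close>. It is written as
  an infinite series, whose terms eventually vanish, so that it can be compared with
  \<open>Bessel_H\<close> term by term.\<close>

lemma prod_Bessel_poly_zeros:
  assumes \<nu>: "\<nu> > real n - 1" and "k > 0"
  shows "(\<lambda>m. of_real (Gamma (\<nu> - real n + 1)) * (fps_nth (Bessel_fps \<nu> n) m * w ^ m * of_real (falling_ratio k m)))
           sums (\<Prod>a\<in>Bessel_poly_zeros \<nu> n k. 1 - w / of_real a)"
proof -
  define p where "p = map_poly complex_of_real (Bessel_poly \<nu> n k)"
  define S where "S = {x. 0 < x \<and> poly (Bessel_poly \<nu> n k) x = 0}"
  define y where "y = w / of_real (4 * real k)"
  have "Gamma (\<nu> - real n + 1) > 0"
    using \<nu> by (intro Gamma_real_pos) auto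
  hence G: "Gamma (\<nu> - real n + 1) \<noteq> 0" by simp
  have rooted: "pos_rooted (Bessel_poly \<nu> n k)"
    by (rule pos_rooted_Bessel_poly[OF \<nu>])
  have "finite S"
    unfolding S_def using rooted
    by (intro finite_subset[OF _ poly_roots_finite[of "Bessel_poly \<nu> n k"]]) (auto simp: pos_rooted_def)
  have coeff: "coeff p m = fps_nth (Bessel_fps \<nu> n) m * of_real (fact m * 4 ^ m * real (k choose m))" for m
    unfolding p_def using \<nu> by (simp add: coeff_map_poly coeff_Bessel_poly del: of_real_mult)
  have "poly p y = poly p 0 * (\<Prod>a\<in>of_real ` S. 1 - y / a)"
  proof (rule poly_eq_prod_roots)
    have "degree p \<le> degree (Bessel_poly \<nu> n k)"
      unfolding p_def by (rule degree_le) (simp add: coeff_map_poly coeff_eq_0)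
    thus "degree p \<le> card (complex_of_real ` S)"
      using rooted by (simp add: card_image inj_on_def pos_rooted_def S_def)
  next
    fix a assume "a \<in> complex_of_real ` S"
    then obtain x where x: "a = of_real x" "0 < x" "poly (Bessel_poly \<nu> n k) x = 0"
      by (auto simp: S_def)
    have "poly p (of_real x) = of_real (poly (Bessel_poly \<nu> n k) x)"
      unfolding p_def by (rule poly_map_poly_of_real)
    thus "a \<noteq> 0 \<and> poly p a = 0" using x by simp
  qed (use \<open>finite S\<close> in auto)
  also have "(\<Prod>a\<in>of_real ` S. 1 - y / a) = (\<Prod>a\<in>S. 1 - y / of_real a)"
    by (subst prod.reindex) (auto simp: inj_on_def)
  also have "\<dots> = (\<Prod>a\<in>Bessel_poly_zeros \<nu> n k. 1 - w / of_real a)"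
    unfolding Bessel_poly_zeros_def S_def[symmetric] using \<open>k > 0\<close>
    by (subst prod.reindex) (auto simp: inj_on_def y_def mult.assoc)
  also have "poly p 0 = of_real (1 / Gamma (\<nu> - real n + 1))"
    using Bessel_fps_nth_0[OF \<nu>] coeff[of 0] by (simp add: poly_0_coeff_0)
  finally have prod: "(\<Prod>a\<in>Bessel_poly_zeros \<nu> n k. 1 - w / of_real a) = of_real (Gamma (\<nu> - real n + 1)) * poly p y"
    using G by simp
  have "(\<lambda>m. coeff p m * y ^ m) sums (\<Sum>m\<le>degree p. coeff p m * y ^ m)"
    by (rule sums_finite) (auto simp: coeff_eq_0)
  moreover have "coeff p m * y ^ m = fps_nth (Bessel_fps \<nu> n) m * w ^ m * of_real (falling_ratio k m)" for m
    using \<open>k > 0\<close> by (simp add: coeff y_def falling_ratio_def power_divide power_mult_distrib)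
  ultimately show ?thesis
    unfolding prod poly_altdef by (intro sums_mult) simp
qed

text \<open>On a disc of radius \<open>R\<close> the deviation is at most a sum independent of
  \<open>w\<close>, which tends to 0 by Tannery's theorem with majorant \<open>G |b m| R^m\<close>.
  The index \<open>Suc N\<close> avoids \<open>k = 0\<close>, where the scaling by
  \<open>4 k\<close> degenerates.\<close>

lemma product_limit_Bessel:
  assumes \<nu>: "\<nu> > real n - 1"
  shows "product_limit (Bessel_H \<nu> n) (\<lambda>N. Bessel_poly_zeros \<nu> n (Suc N))"
proof
  have "\<nu> > -1" using \<nu> by linarith
  define G b where "G = Gamma (\<nu> - real n + 1)" and "b = fps_nth (Bessel_fps \<nu> n)"
  have "G > 0" using \<nu> by (auto simp: G_def intro: Gamma_real_pos)
  fix R :: real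
  show "uniform_limit (cball 0 R) (\<lambda>N w. \<Prod>a\<in>Bessel_poly_zeros \<nu> n (Suc N). 1 - w / of_real a)
          (Bessel_H \<nu> n) sequentially"
  proof (cases "R \<ge> 0")
    case True
    define d where "d N m = G * (norm (b m) * R ^ m) * (1 - falling_ratio (Suc N) m)" for N m
    have summable_b: "summable (\<lambda>m. norm (b m) * r ^ m)" if "r \<ge> 0" for r
    proof -
      have "summable (\<lambda>m. norm (b m * of_real r ^ m))"
        using \<open>\<nu> > -1\<close> unfolding b_def by (intro abs_summable_in_conv_radius) (auto simp flip: fps_conv_radius_def)
      thus ?thesis using that by (simp add: norm_mult norm_power)
    qed
    have d_bounds: "0 \<le> d N m" "d N m \<le> G * (norm (b m) * R ^ m)" for N m
      using falling_ratio_bounds[of "Suc N" m] True \<open>G > 0\<close> unfolding d_def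
      by (intro mult_nonneg_nonneg mult_left_le; simp)+
    have summable_d: "summable (d N)" for N
      by (rule summable_comparison_test'[OF summable_mult[OF summable_b[OF True], of G], of 0])
        (use d_bounds in auto)
    have lim: "(\<lambda>N. suminf (d N)) \<longlonglongrightarrow> (\<Sum>m. 0)"
    proof (rule tannerys_theorem[THEN conjunct2, THEN conjunct2])
      fix m
      have "(\<lambda>N. G * (norm (b m) * R ^ m) * (1 - falling_ratio (Suc N) m)) \<longlonglongrightarrow> G * (norm (b m) * R ^ m) * (1 - 1)"
        by (intro tendsto_intros LIMSEQ_Suc falling_ratio_tendsto)
      thus "(\<lambda>N. d N m) \<longlonglongrightarrow> 0" by (simp add: d_def)
      show "summable (\<lambda>m. G * (norm (b m) * R ^ m))"
        by (intro summable_mult summable_b True)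
    qed (use d_bounds in \<open>auto simp: case_prod_unfold intro!: always_eventually\<close>)
    show ?thesis
    proof (rule uniform_limitI)
      fix e :: real assume "e > 0"
      have "eventually (\<lambda>N. suminf (d N) < e) sequentially"
        using lim \<open>e > 0\<close> by (intro order_tendstoD(2)) auto
      thus "eventually (\<lambda>N. \<forall>w\<in>cball 0 R. dist (\<Prod>a\<in>Bessel_poly_zeros \<nu> n (Suc N). 1 - w / of_real a) (Bessel_H \<nu> n w) < e) sequentially"
      proof eventually_elim
        case (elim N)
        show ?case
        proof
          fix w :: complex assume w: "w \<in> cball 0 R"
          have "(\<lambda>m. b m * w ^ m) sums eval_fps (Bessel_fps \<nu> n) w"
            unfolding b_def using \<open>\<nu> > -1\<close> by (intro sums_eval_fps) auto
          hence "(\<lambda>m. of_real G * (b m * w ^ m)) sums Bessel_H \<nu> n w"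
            unfolding Bessel_H_def G_def by (rule sums_mult)
          moreover have "(\<lambda>m. of_real G * (b m * w ^ m * of_real (falling_ratio (Suc N) m)))
              sums (\<Prod>a\<in>Bessel_poly_zeros \<nu> n (Suc N). 1 - w / of_real a)"
            unfolding G_def b_def by (rule prod_Bessel_poly_zeros[OF \<nu>]) simp
          ultimately have s: "(\<lambda>m. of_real G * (b m * w ^ m) - of_real G * (b m * w ^ m * of_real (falling_ratio (Suc N) m)))
              sums (Bessel_H \<nu> n w - (\<Prod>a\<in>Bessel_poly_zeros \<nu> n (Suc N). 1 - w / of_real a))"
            by (rule sums_diff)
          have le: "norm (of_real G * (b m * w ^ m) - of_real G * (b m * w ^ m * of_real (falling_ratio (Suc N) m))) \<le> d N m" for m
          proof -
            have "of_real G * (b m * w ^ m) - of_real G * (b m * w ^ m * of_real (falling_ratio (Suc N) m))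
                = of_real (G * (1 - falling_ratio (Suc N) m)) * (b m * w ^ m)"
              by (simp add: algebra_simps)
            also have "norm \<dots> = G * (1 - falling_ratio (Suc N) m) * (norm (b m) * norm w ^ m)"
              using \<open>G > 0\<close> falling_ratio_bounds[of "Suc N" m]
              unfolding norm_mult norm_of_real norm_power by (simp add: abs_mult)
            also have "\<dots> \<le> G * (1 - falling_ratio (Suc N) m) * (norm (b m) * R ^ m)"
              using \<open>G > 0\<close> falling_ratio_bounds[of "Suc N" m] w
              by (intro mult_left_mono power_mono mult_nonneg_nonneg) auto
            finally show ?thesis by (simp add: d_def mult_ac)
          qed
          have "norm (Bessel_H \<nu> n w - (\<Prod>a\<in>Bessel_poly_zeros \<nu> n (Suc N). 1 - w / of_real a)) \<le> suminf (d N)"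
            unfolding sums_unique[OF s] by (rule norm_suminf_le[OF le summable_d])
          thus "dist (\<Prod>a\<in>Bessel_poly_zeros \<nu> n (Suc N). 1 - w / of_real a) (Bessel_H \<nu> n w) < e"
            using elim by (simp add: dist_norm norm_minus_commute)
        qed
      qed
    qed
  qed auto
next
  fix N
  have "Bessel_poly \<nu> n (Suc N) \<noteq> 0"
    using pos_rooted_Bessel_poly[OF \<nu>] by (auto simp: pos_rooted_def)
  thus "finite (Bessel_poly_zeros \<nu> n (Suc N))"
    unfolding Bessel_poly_zeros_def by (intro finite_imageI finite_subset[OF _ poly_roots_finite]) auto
  fix a assume "a \<in> Bessel_poly_zeros \<nu> n (Suc N)"
  thus "0 < a" by (auto simp: Bessel_poly_zeros_def)
next
  have "\<nu> > -1" using \<nu> by linarith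
  have "(Bessel_H \<nu> n has_field_derivative of_real (Gamma (\<nu> - real n + 1)) * eval_fps (fps_deriv (Bessel_fps \<nu> n)) 0) (at 0)"
    unfolding Bessel_H_def using \<open>\<nu> > -1\<close>
    by (auto intro!: derivative_eq_intros has_field_derivative_eval_fps)
  hence "deriv (Bessel_H \<nu> n) 0 = of_real (Gamma (\<nu> - real n + 1)) * fps_nth (Bessel_fps \<nu> n) 1"
    by (simp add: DERIV_imp_deriv eval_fps_at_0)
  \<comment> \<open>These are the Gamma values occurring in the coefficient of \<open>w\<close>;
    their positivity keeps that coefficient away from 0.\<close>
  moreover have "Gamma (\<nu> - real n + 1) > 0" "Gamma (2 + \<nu> + 1) > 0"
      "Gamma (2 - real n + \<nu> + 1) > 0" "Gamma (1 + \<nu> + 1) > 0"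
    using \<nu> by (auto intro!: Gamma_real_pos)
  ultimately show "deriv (Bessel_H \<nu> n) 0 \<noteq> 0"
    by (auto simp: Bessel_fps_def rGamma_inverse_Gamma)
qed

section \<open>Derivatives of \<open>J\<close> and \<open>I\<close>, and the root equations\<close>

lemma Bessel_E_conv_Bessel_H:
  "\<nu> > -1 \<Longrightarrow> Bessel_E \<nu> n z = Bessel_H \<nu> n (z\<^sup>2)"
  by (simp add: Bessel_E_conv_Bessel_fps Bessel_H_def)

text \<open>Evaluation at \<open>- z^2\<close> cancels the alternating sign of the coefficients, so
  \<open>I\<close> and \<open>J\<close> share one power series.\<close>

lemma Bessel_I_conv_Bessel_fps:
  assumes "\<nu> > -1" "z \<noteq> 0"
  shows "Bessel_I \<nu> z
      = of_real (2 powr (-\<nu>)) * (z powr of_real \<nu> * eval_fps (Bessel_fps \<nu> 0) (- z\<^sup>2))"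
proof -
  define c where "c = of_real (2 powr (-\<nu>)) * z powr of_real \<nu>"
  \<comment> \<open>Division by a positive number leaves the argument unchanged, so the principal
    power of \<open>z / 2\<close> splits for every nonzero \<open>z\<close>.\<close>
  have Ln: "Ln (z / 2) = Ln z - of_real (ln 2)"
    using Ln_divide_of_real[of 2 z] assms by simp
  have "of_real \<nu> * Ln (z / 2) = of_real (- \<nu> * ln 2) + of_real \<nu> * Ln z"
    unfolding Ln by (simp add: algebra_simps)
  hence half: "(z / 2) powr of_real \<nu> = c"
    using assms unfolding c_def powr_def by (simp only: exp_add exp_of_real) simp
  have pow: "rpow (z / 2) (2 * real m + \<nu>) = c * ((z\<^sup>2) ^ m / 4 ^ m)" for m
  proof -
    have "rpow (z / 2) (2 * real m + \<nu>) = (z / 2) powr (of_real (2 * real m + \<nu>))"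
      using assms by (cases "2 * real m + \<nu> = 0") (simp_all add: rpow_def del: of_real_add)
    also have "of_real (2 * real m + \<nu>) = of_nat (2 * m) + (of_real \<nu> :: complex)"
      by simp
    also have "(z / 2) powr \<dots> = (z / 2) ^ (2 * m) * (z / 2) powr of_real \<nu>"
      using assms by (subst powr_add, subst powr_nat) auto
    also have "\<dots> = c * ((z\<^sup>2) ^ m / 4 ^ m)"
      by (subst half) (simp add: power_mult power_divide power_mult_distrib)
    finally show ?thesis .
  qed
  have "(\<lambda>m. c * (fps_nth (Bessel_fps \<nu> 0) m * (- z\<^sup>2) ^ m)) sums (c * eval_fps (Bessel_fps \<nu> 0) (- z\<^sup>2))"
    using assms by (intro sums_mult sums_eval_fps) auto
  moreover have "of_real (1 / (fact m * Gamma (real m + \<nu> + 1))) * rpow (z / 2) (2 * real m + \<nu>)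
      = c * (fps_nth (Bessel_fps \<nu> 0) m * (- z\<^sup>2) ^ m)" for m
    using assms unfolding pow power_minus[of "z\<^sup>2"]
    by (simp add: Bessel_fps_0_nth rGamma_inverse_Gamma field_simps flip: power_mult_distrib)
  ultimately show ?thesis
    by (simp add: Bessel_I_def c_def mult.assoc sums_iff)
qed

lemma eval_Bessel_fps_Suc:
  assumes "\<nu> > -1"
  shows "eval_fps (Bessel_fps \<nu> (Suc n)) w = of_real (\<nu> - real n) * eval_fps (Bessel_fps \<nu> n) w
           + 2 * (w * eval_fps (fps_deriv (Bessel_fps \<nu> n)) w)"
proof -
  define B where "B = Bessel_fps \<nu> n"
  have rad: "fps_conv_radius B = \<infinity>" "fps_conv_radius (fps_deriv B) = \<infinity>"
    using assms fps_conv_radius_deriv[of B] by (simp_all add: B_def)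
  have X: "fps_conv_radius (fps_X * fps_deriv B) = \<infinity>"
    using fps_conv_radius_mult[of fps_X "fps_deriv B"] by (simp add: rad)
  have c: "fps_conv_radius (fps_const a * p) = \<infinity>"
    if "fps_conv_radius p = \<infinity>" for a :: complex and p
    using fps_conv_radius_mult[of "fps_const a" p] that by simp
  show ?thesis
    unfolding Bessel_fps_Suc B_def[symmetric]
    by (simp add: eval_fps_add eval_fps_mult c X rad del: of_real_diff)
qed

text \<open>The recursion for \<open>Bessel_fps\<close> fits here as it does for \<open>J\<close>,
  because \<open>z d/dz\<close> becomes \<open>2 w d/dw\<close> both for \<open>w = z^2\<close> and
  for \<open>w = - z^2\<close>.\<close>

lemma higher_deriv_Bessel_I:
  assumes "\<nu> > -1" "z \<notin> \<real>\<^sub>\<le>\<^sub>0"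
  shows "(deriv ^^ n) (Bessel_I \<nu>) z
      = of_real (2 powr (-\<nu>)) * (z powr of_real (\<nu> - real n) * eval_fps (Bessel_fps \<nu> n) (- z\<^sup>2))"
  using assms(2)
proof (induction n arbitrary: z)
  case 0
  thus ?case
    using Bessel_I_conv_Bessel_fps[of \<nu> z] assms by (cases "z = 0") auto
next
  case (Suc n)
  define B where "B = Bessel_fps \<nu> n"
  define G where "G = (\<lambda>z. of_real (2 powr (-\<nu>)) * (z powr of_real (\<nu> - real n) * eval_fps B (- z\<^sup>2)))"
  have rad: "fps_conv_radius B = \<infinity>" "fps_conv_radius (fps_deriv B) = \<infinity>"
    using assms fps_conv_radius_deriv[of B] by (simp_all add: B_def)
  have "z \<noteq> 0"
    using Suc.prems by auto
  have "\<forall>\<^sub>F w in nhds z. w \<in> - \<real>\<^sub>\<le>\<^sub>0"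
    using Suc.prems by (intro eventually_nhds_in_open) auto
  hence "\<forall>\<^sub>F w in nhds z. (deriv ^^ n) (Bessel_I \<nu>) w = G w"
    by eventually_elim (use Suc.IH in \<open>simp add: G_def B_def\<close>)
  hence "(deriv ^^ Suc n) (Bessel_I \<nu>) z = deriv G z"
    by (auto intro: deriv_cong_ev)
  also have "deriv G z = of_real (2 powr (-\<nu>))
      * (of_real (\<nu> - real n) * z powr (of_real (\<nu> - real n) - 1) * eval_fps B (- z\<^sup>2)
        + eval_fps (fps_deriv B) (- z\<^sup>2) * (- (2 * z)) * z powr of_real (\<nu> - real n))"
  proof -
    have "((\<lambda>z. eval_fps B (- z\<^sup>2)) has_field_derivative
        eval_fps (fps_deriv B) (- z\<^sup>2) * (- (2 * z))) (at z)"
      by (rule DERIV_chain2[where f = "eval_fps B" and g = "\<lambda>z. - z\<^sup>2"])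
        (auto intro!: derivative_eq_intros has_field_derivative_eval_fps simp: rad)
    thus ?thesis
      unfolding G_def
      by (intro DERIV_imp_deriv DERIV_cmult DERIV_mult has_field_derivative_powr Suc.prems)
  qed
  also have "z powr of_real (\<nu> - real n) = z powr of_real (\<nu> - real (Suc n)) * z"
  proof -
    have "of_real (\<nu> - real n) = of_real (\<nu> - real (Suc n)) + (1 :: complex)" by simp
    thus ?thesis using \<open>z \<noteq> 0\<close> by (simp only: powr_add powr_to_1)
  qed
  also have "of_real (\<nu> - real n) - 1 = (of_real (\<nu> - real (Suc n)) :: complex)"
    by simp
  also have "of_real (\<nu> - real n) * z powr of_real (\<nu> - real (Suc n)) * eval_fps B (- z\<^sup>2)
        + eval_fps (fps_deriv B) (- z\<^sup>2) * (- (2 * z)) * (z powr of_real (\<nu> - real (Suc n)) * z)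
      = z powr of_real (\<nu> - real (Suc n)) * (of_real (\<nu> - real n) * eval_fps B (- z\<^sup>2)
        + 2 * (- z\<^sup>2 * eval_fps (fps_deriv B) (- z\<^sup>2)))"
    by (simp add: algebra_simps power2_eq_square)
  also have "of_real (\<nu> - real n) * eval_fps B (- z\<^sup>2) + 2 * (- z\<^sup>2 * eval_fps (fps_deriv B) (- z\<^sup>2))
      = eval_fps (Bessel_fps \<nu> (Suc n)) (- z\<^sup>2)"
    using eval_Bessel_fps_Suc[OF assms(1)] by (simp add: B_def)
  finally show ?case .
qed


text \<open>Treats \<open>J\<close> with \<open>w = r^2\<close> and \<open>I\<close> with
  \<open>w = - r^2\<close> at once. The constant \<open>K\<close> and the powers of \<open>r\<close>
  cancel, leaving \<open>((\<nu> - n) B + 2 w B') / B\<close> for the series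
  \<open>B\<close>.\<close>

lemma deriv_quotient_eq_euler_quot:
  fixes r a :: real and D0 D1 w K :: complex
  assumes \<nu>: "\<nu> > real n - 1" and "r > 0" "K \<noteq> 0"
    and D0: "D0 = K * (of_real r powr of_real (\<nu> - real n) * eval_fps (Bessel_fps \<nu> n) w)"
    and D1: "D1 = K * (of_real r powr of_real (\<nu> - real (Suc n)) * eval_fps (Bessel_fps \<nu> (Suc n)) w)"
  shows "D0 \<noteq> 0 \<longleftrightarrow> Bessel_H \<nu> n w \<noteq> 0"
    and "D0 \<noteq> 0 \<Longrightarrow> of_real r * D1 / D0 = of_real (\<nu> - real n) + 2 * euler_quot (Bessel_H \<nu> n) w"
proof -
  have "\<nu> > -1" using \<nu> by linarith
  define G where "G = Gamma (\<nu> - real n + 1)"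
  have "G > 0" unfolding G_def using \<nu> by (intro Gamma_real_pos) auto
  define B where "B = eval_fps (Bessel_fps \<nu> n) w"
  define B' where "B' = eval_fps (fps_deriv (Bessel_fps \<nu> n)) w"
  define q where "q = complex_of_real r powr of_real (\<nu> - real (Suc n))"
  have "q \<noteq> 0" using \<open>r > 0\<close> by (simp add: q_def)
  have "of_real (\<nu> - real n) = of_real (\<nu> - real (Suc n)) + (1 :: complex)" by simp
  hence pow: "complex_of_real r powr of_real (\<nu> - real n) = q * of_real r"
    using \<open>r > 0\<close> unfolding q_def by (simp only: powr_add powr_to_1)
  have H: "Bessel_H \<nu> n w = of_real G * B"
    by (simp add: Bessel_H_def G_def B_def)
  show iff: "D0 \<noteq> 0 \<longleftrightarrow> Bessel_H \<nu> n w \<noteq> 0"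
    using assms(2,3) \<open>q \<noteq> 0\<close> \<open>G > 0\<close> unfolding D0 H pow B_def[symmetric] by auto
  assume "D0 \<noteq> 0"
  hence "B \<noteq> 0" using iff H by auto
  have "(Bessel_H \<nu> n has_field_derivative of_real G * B') (at w)"
    unfolding Bessel_H_def G_def B'_def using \<open>\<nu> > -1\<close>
    by (auto intro!: derivative_eq_intros has_field_derivative_eval_fps)
  hence quot: "euler_quot (Bessel_H \<nu> n) w = w * B' / B"
    using \<open>G > 0\<close> by (simp add: euler_quot_def DERIV_imp_deriv H)
  have "of_real r * D1 / D0 = (of_real (\<nu> - real n) * B + 2 * (w * B')) / B"
    using assms(2,3) \<open>q \<noteq> 0\<close> unfolding D0 D1 pow eval_Bessel_fps_Suc[OF \<open>\<nu> > -1\<close>]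
      B_def[symmetric] B'_def[symmetric] q_def[symmetric] by (simp add: divide_simps)
  also have "\<dots> = of_real (\<nu> - real n) + 2 * euler_quot (Bessel_H \<nu> n) w"
    using \<open>B \<noteq> 0\<close> unfolding quot by (simp add: add_divide_distrib)
  finally show "of_real r * D1 / D0 = of_real (\<nu> - real n) + 2 * euler_quot (Bessel_H \<nu> n) w" .
qed

lemma Bessel_J_deriv_quotient:
  assumes "\<nu> > real n - 1" "r > 0"
  shows "(deriv ^^ n) (Bessel_J \<nu>) (of_real r) \<noteq> 0 \<longleftrightarrow> Bessel_H \<nu> n (of_real (r ^ 2)) \<noteq> 0"
    and "(deriv ^^ n) (Bessel_J \<nu>) (of_real r) \<noteq> 0 \<Longrightarrow>
      of_real r * (deriv ^^ (n + 1)) (Bessel_J \<nu>) (of_real r) / (deriv ^^ n) (Bessel_J \<nu>) (of_real r)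
        = of_real (\<nu> - real n) + 2 * euler_quot (Bessel_H \<nu> n) (of_real (r ^ 2))"
proof -
  have "\<nu> > -1" "complex_of_real r \<notin> \<real>\<^sub>\<le>\<^sub>0" using assms by auto
  note J = higher_deriv_Bessel_J_aux[OF this, folded of_real_power]
  note quot = deriv_quotient_eq_euler_quot[OF assms _ J J]
  show "(deriv ^^ n) (Bessel_J \<nu>) (of_real r) \<noteq> 0 \<longleftrightarrow> Bessel_H \<nu> n (of_real (r ^ 2)) \<noteq> 0"
    by (rule quot) simp
  show "of_real r * (deriv ^^ (n + 1)) (Bessel_J \<nu>) (of_real r) / (deriv ^^ n) (Bessel_J \<nu>) (of_real r)
        = of_real (\<nu> - real n) + 2 * euler_quot (Bessel_H \<nu> n) (of_real (r ^ 2))"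
    if "(deriv ^^ n) (Bessel_J \<nu>) (of_real r) \<noteq> 0"
    unfolding Suc_eq_plus1[symmetric] by (rule quot(2)[OF _ that]) simp
qed

lemma Bessel_I_deriv_quotient:
  assumes "\<nu> > real n - 1" "r > 0"
  shows "(deriv ^^ n) (Bessel_I \<nu>) (of_real r) \<noteq> 0 \<longleftrightarrow> Bessel_H \<nu> n (of_real (- (r ^ 2))) \<noteq> 0"
    and "(deriv ^^ n) (Bessel_I \<nu>) (of_real r) \<noteq> 0 \<Longrightarrow>
      of_real r * (deriv ^^ (n + 1)) (Bessel_I \<nu>) (of_real r) / (deriv ^^ n) (Bessel_I \<nu>) (of_real r)
        = of_real (\<nu> - real n) + 2 * euler_quot (Bessel_H \<nu> n) (of_real (- (r ^ 2)))"
proof -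
  have "\<nu> > -1" "complex_of_real r \<notin> \<real>\<^sub>\<le>\<^sub>0" using assms by auto
  note I = higher_deriv_Bessel_I[OF this, folded of_real_power of_real_minus]
  note quot = deriv_quotient_eq_euler_quot[OF assms _ I I]
  show "(deriv ^^ n) (Bessel_I \<nu>) (of_real r) \<noteq> 0 \<longleftrightarrow> Bessel_H \<nu> n (of_real (- (r ^ 2))) \<noteq> 0"
    by (rule quot) simp
  show "of_real r * (deriv ^^ (n + 1)) (Bessel_I \<nu>) (of_real r) / (deriv ^^ n) (Bessel_I \<nu>) (of_real r)
        = of_real (\<nu> - real n) + 2 * euler_quot (Bessel_H \<nu> n) (of_real (- (r ^ 2)))"
    if "(deriv ^^ n) (Bessel_I \<nu>) (of_real r) \<noteq> 0"
    unfolding Suc_eq_plus1[symmetric] by (rule quot(2)[OF _ that]) simp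
qed


lemma affine_eq_0_iff:
  fixes z :: complex and d c :: real
  shows "of_real d + 2 * z + of_real c = 0 \<longleftrightarrow> z = of_real (- ((d + c) / 2))"
proof -
  have "of_real d + 2 * z + of_real c = 2 * (z - of_real (- ((d + c) / 2)))"
    by (simp add: field_simps)
  thus ?thesis by (simp only: mult_eq_0_iff right_minus_eq) simp
qed

text \<open>The constant \<open>c\<close> absorbs the differences between the equations: it is
  \<open>n + 1 - \<nu> - \<beta>\<close> for \<open>g\<close>,
  \<open>n + 2 - \<nu> - 2 \<beta>\<close> for \<open>h\<close> at the argument
  \<open>sqrt r\<close>, and \<open>- (\<nu> - n) \<beta>\<close> for \<open>f\<close> after
  multiplication by \<open>\<nu> - n\<close>.\<close>

lemma Bessel_J_root_iff:
  assumes "\<nu> > real n - 1" "r > 0"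
  shows "((deriv ^^ n) (Bessel_J \<nu>) (of_real r) \<noteq> 0 \<and>
           of_real r * (deriv ^^ (n + 1)) (Bessel_J \<nu>) (of_real r)
             / (deriv ^^ n) (Bessel_J \<nu>) (of_real r) + of_real c = 0) \<longleftrightarrow>
         Bessel_H \<nu> n (of_real (r ^ 2)) \<noteq> 0 \<and>
           euler_quot (Bessel_H \<nu> n) (of_real (r ^ 2)) = of_real (- ((\<nu> - real n + c) / 2))"
  using Bessel_J_deriv_quotient[OF assms] affine_eq_0_iff by metis

lemma Bessel_I_root_iff:
  assumes "\<nu> > real n - 1" "r > 0"
  shows "((deriv ^^ n) (Bessel_I \<nu>) (of_real r) \<noteq> 0 \<and>
           of_real r * (deriv ^^ (n + 1)) (Bessel_I \<nu>) (of_real r)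
             / (deriv ^^ n) (Bessel_I \<nu>) (of_real r) + of_real c = 0) \<longleftrightarrow>
         Bessel_H \<nu> n (of_real (- (r ^ 2))) \<noteq> 0 \<and>
           euler_quot (Bessel_H \<nu> n) (of_real (- (r ^ 2))) = of_real (- ((\<nu> - real n + c) / 2))"
  using Bessel_I_deriv_quotient[OF assms] affine_eq_0_iff by metis

section \<open>The radii of the normalized Bessel functions\<close>

theorem theorem3p1:
  fixes n :: nat and \<nu> \<beta> :: real
  assumes "0 \<le> \<beta>" and "\<beta> < 1"
  shows
    "(\<nu> > real n \<longrightarrow>
        (\<exists>x. smallest_positive_root (\<lambda>r.
              (deriv ^^ n) (Bessel_J \<nu>) (of_real r) \<noteq> 0 \<and>
              of_real r * (deriv ^^ (n + 1)) (Bessel_J \<nu>) (of_real r)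
                / (of_real (\<nu> - real n) * (deriv ^^ n) (Bessel_J \<nu>) (of_real r))
                - of_real \<beta> = 0) x
          \<and> starlikeness_radius \<beta> (Bessel_f \<nu> n) = ereal x))
     \<and> (real n - 1 < \<nu> \<and> \<nu> < real n \<longrightarrow>
        (\<exists>x. smallest_positive_root (\<lambda>r.
              (deriv ^^ n) (Bessel_I \<nu>) (of_real r) \<noteq> 0 \<and>
              of_real r * (deriv ^^ (n + 1)) (Bessel_I \<nu>) (of_real r)
                / (of_real (\<nu> - real n) * (deriv ^^ n) (Bessel_I \<nu>) (of_real r))
                - of_real \<beta> = 0) x
          \<and> starlikeness_radius \<beta> (Bessel_f \<nu> n) = ereal x))
     \<and> (\<nu> > real n - 1 \<longrightarrow>
        (\<exists>y. smallest_positive_root (\<lambda>r.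
              (deriv ^^ n) (Bessel_J \<nu>) (of_real r) \<noteq> 0 \<and>
              of_real r * (deriv ^^ (n + 1)) (Bessel_J \<nu>) (of_real r)
                / (deriv ^^ n) (Bessel_J \<nu>) (of_real r)
                + of_real (real n + 1 - \<nu> - \<beta>) = 0) y
          \<and> starlikeness_radius \<beta> (Bessel_g \<nu> n) = ereal y))
     \<and> (\<nu> > real n - 1 \<longrightarrow>
        (\<exists>z. smallest_positive_root (\<lambda>r.
              (deriv ^^ n) (Bessel_J \<nu>) (of_real (sqrt r)) \<noteq> 0 \<and>
              of_real (sqrt r) * (deriv ^^ (n + 1)) (Bessel_J \<nu>) (of_real (sqrt r))
                / (deriv ^^ n) (Bessel_J \<nu>) (of_real (sqrt r))
                + of_real (real n + 2 - \<nu> - 2 * \<beta>) = 0) z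
          \<and> starlikeness_radius \<beta> (Bessel_h \<nu> n) = ereal z))"
proof (intro conjI impI)
  \<comment> \<open>Brings the equation for \<open>f\<close> into the common form. For
    \<open>D = 0\<close> both quotients are 0 by convention and both sides reduce to
    \<open>\<beta> = 0\<close>.\<close>
  have scaled: "X / (of_real d * D) - of_real \<beta> = 0 \<longleftrightarrow> X / D + of_real (- d * \<beta>) = 0"
    if "d \<noteq> 0" for X D :: complex and d :: real
    using that by (cases "D = 0") (auto simp: field_simps)
  {
    assume "\<nu> > real n"
    hence \<nu>: "\<nu> > real n - 1" "\<nu> > -1" "\<nu> - real n > 0" by linarith+
    interpret product_limit "Bessel_H \<nu> n" "\<lambda>N. Bessel_poly_zeros \<nu> n (Suc N)"
      by (rule product_limit_Bessel[OF \<nu>(1)])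
    have f: "Bessel_f \<nu> n z = z * Bessel_H \<nu> n (z\<^sup>2) powr of_real (1 / (\<nu> - real n))" for z
      unfolding Bessel_f_def Bessel_E_conv_Bessel_H[OF \<nu>(2)] ..
    have "(\<nu> - real n + - (\<nu> - real n) * \<beta>) / 2 = (1 - \<beta>) / (real 2 * (1 / (\<nu> - real n)))"
      using \<nu>(3) by (simp add: field_simps)
    hence "(deriv ^^ n) (Bessel_J \<nu>) (of_real r) \<noteq> 0 \<and>
          of_real r * (deriv ^^ (n + 1)) (Bessel_J \<nu>) (of_real r)
            / (of_real (\<nu> - real n) * (deriv ^^ n) (Bessel_J \<nu>) (of_real r)) - of_real \<beta> = 0
        \<longleftrightarrow> Bessel_H \<nu> n (of_real (r\<^sup>2)) \<noteq> 0 \<and> euler_quot (Bessel_H \<nu> n) (of_real (r\<^sup>2))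
              = of_real (- ((1 - \<beta>) / (real 2 * (1 / (\<nu> - real n)))))" if "r > 0" for r
      using Bessel_J_root_iff[OF \<nu>(1) that, of "- (\<nu> - real n) * \<beta>"] scaled[of "\<nu> - real n"] \<nu>(3)
      by (simp only: order_less_irrefl less_imp_neq[THEN not_sym] simp_thms)
    from smallest_positive_root_cong[OF this]
    show "\<exists>x. smallest_positive_root (\<lambda>r.
              (deriv ^^ n) (Bessel_J \<nu>) (of_real r) \<noteq> 0 \<and>
              of_real r * (deriv ^^ (n + 1)) (Bessel_J \<nu>) (of_real r)
                / (of_real (\<nu> - real n) * (deriv ^^ n) (Bessel_J \<nu>) (of_real r))
                - of_real \<beta> = 0) x
          \<and> starlikeness_radius \<beta> (Bessel_f \<nu> n) = ereal x"
      using starlikeness_radius_pos_exponent[of \<beta> "1 / (\<nu> - real n)" 2, OF _ _ _ f] assms \<nu>(3) by simp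
  next
    assume "real n - 1 < \<nu> \<and> \<nu> < real n"
    \<comment> \<open>As \<open>\<nu> - n\<close> lies strictly between -1 and 0, the exponent
      \<open>1 / (\<nu> - n)\<close> is below -1, as the case of a negative exponent
      requires.\<close>
    hence \<nu>: "\<nu> > real n - 1" "\<nu> > -1" "\<nu> - real n < 0" "1 / (\<nu> - real n) < - 1"
      by (simp_all add: field_simps)
    interpret product_limit "Bessel_H \<nu> n" "\<lambda>N. Bessel_poly_zeros \<nu> n (Suc N)"
      by (rule product_limit_Bessel[OF \<nu>(1)])
    have f: "Bessel_f \<nu> n z = z * Bessel_H \<nu> n (z\<^sup>2) powr of_real (1 / (\<nu> - real n))" for z
      unfolding Bessel_f_def Bessel_E_conv_Bessel_H[OF \<nu>(2)] ..
    have "(\<nu> - real n + - (\<nu> - real n) * \<beta>) / 2 = (1 - \<beta>) / (2 * (1 / (\<nu> - real n)))"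
      using \<nu>(3) by (simp add: field_simps)
    hence "(deriv ^^ n) (Bessel_I \<nu>) (of_real r) \<noteq> 0 \<and>
          of_real r * (deriv ^^ (n + 1)) (Bessel_I \<nu>) (of_real r)
            / (of_real (\<nu> - real n) * (deriv ^^ n) (Bessel_I \<nu>) (of_real r)) - of_real \<beta> = 0
        \<longleftrightarrow> Bessel_H \<nu> n (of_real (- (r\<^sup>2))) \<noteq> 0 \<and> euler_quot (Bessel_H \<nu> n) (of_real (- (r\<^sup>2)))
              = of_real (- ((1 - \<beta>) / (2 * (1 / (\<nu> - real n)))))" if "r > 0" for r
      using Bessel_I_root_iff[OF \<nu>(1) that, of "- (\<nu> - real n) * \<beta>"] scaled[of "\<nu> - real n"] \<nu>(3)
      by (simp only: order_less_irrefl less_imp_neq simp_thms)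
    from smallest_positive_root_cong[OF this]
    show "\<exists>x. smallest_positive_root (\<lambda>r.
              (deriv ^^ n) (Bessel_I \<nu>) (of_real r) \<noteq> 0 \<and>
              of_real r * (deriv ^^ (n + 1)) (Bessel_I \<nu>) (of_real r)
                / (of_real (\<nu> - real n) * (deriv ^^ n) (Bessel_I \<nu>) (of_real r))
                - of_real \<beta> = 0) x
          \<and> starlikeness_radius \<beta> (Bessel_f \<nu> n) = ereal x"
      using starlikeness_radius_neg_exponent[OF assms \<nu>(4) f] by simp
  next
    assume "\<nu> > real n - 1"
    hence \<nu>: "\<nu> > real n - 1" "\<nu> > -1" by linarith+
    interpret product_limit "Bessel_H \<nu> n" "\<lambda>N. Bessel_poly_zeros \<nu> n (Suc N)"
      by (rule product_limit_Bessel[OF \<nu>(1)])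
    have f: "Bessel_g \<nu> n z = z * Bessel_H \<nu> n (z\<^sup>2) powr of_real 1" for z
      unfolding Bessel_g_def Bessel_E_conv_Bessel_H[OF \<nu>(2)] by simp
    have "(\<nu> - real n + (real n + 1 - \<nu> - \<beta>)) / 2 = (1 - \<beta>) / (real 2 * 1)"
      by simp
    hence "(deriv ^^ n) (Bessel_J \<nu>) (of_real r) \<noteq> 0 \<and>
          of_real r * (deriv ^^ (n + 1)) (Bessel_J \<nu>) (of_real r)
            / (deriv ^^ n) (Bessel_J \<nu>) (of_real r) + of_real (real n + 1 - \<nu> - \<beta>) = 0
        \<longleftrightarrow> Bessel_H \<nu> n (of_real (r\<^sup>2)) \<noteq> 0 \<and> euler_quot (Bessel_H \<nu> n) (of_real (r\<^sup>2))
              = of_real (- ((1 - \<beta>) / (real 2 * 1)))" if "r > 0" for r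
      using Bessel_J_root_iff[OF \<nu>(1) that, of "real n + 1 - \<nu> - \<beta>"] by (simp only:)
    from smallest_positive_root_cong[OF this]
    show "\<exists>y. smallest_positive_root (\<lambda>r.
              (deriv ^^ n) (Bessel_J \<nu>) (of_real r) \<noteq> 0 \<and>
              of_real r * (deriv ^^ (n + 1)) (Bessel_J \<nu>) (of_real r)
                / (deriv ^^ n) (Bessel_J \<nu>) (of_real r)
                + of_real (real n + 1 - \<nu> - \<beta>) = 0) y
          \<and> starlikeness_radius \<beta> (Bessel_g \<nu> n) = ereal y"
      using starlikeness_radius_pos_exponent[of \<beta> 1 2, OF _ _ _ f] assms by simp
  next
    assume "\<nu> > real n - 1"
    hence \<nu>: "\<nu> > real n - 1" "\<nu> > -1" by linarith+
    interpret product_limit "Bessel_H \<nu> n" "\<lambda>N. Bessel_poly_zeros \<nu> n (Suc N)"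
      by (rule product_limit_Bessel[OF \<nu>(1)])
    \<comment> \<open>The square root undoes the squaring in \<open>H(z^2)\<close>, hence
      \<open>k = 1\<close> here, and the root in \<open>w\<close> is the root in \<open>r\<close>
      itself.\<close>
    have f: "Bessel_h \<nu> n z = z * Bessel_H \<nu> n (z ^ 1) powr of_real 1" for z
      unfolding Bessel_h_def Bessel_E_conv_Bessel_H[OF \<nu>(2)] by simp
    have c: "(\<nu> - real n + (real n + 2 - \<nu> - 2 * \<beta>)) / 2 = (1 - \<beta>) / (real 1 * 1)"
      by simp
    have "(deriv ^^ n) (Bessel_J \<nu>) (of_real (sqrt r)) \<noteq> 0 \<and>
          of_real (sqrt r) * (deriv ^^ (n + 1)) (Bessel_J \<nu>) (of_real (sqrt r))
            / (deriv ^^ n) (Bessel_J \<nu>) (of_real (sqrt r)) + of_real (real n + 2 - \<nu> - 2 * \<beta>) = 0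
        \<longleftrightarrow> Bessel_H \<nu> n (of_real (r ^ 1)) \<noteq> 0 \<and> euler_quot (Bessel_H \<nu> n) (of_real (r ^ 1))
              = of_real (- ((1 - \<beta>) / (real 1 * 1)))" if "r > 0" for r
    proof -
      have "sqrt r > 0" "(sqrt r)\<^sup>2 = r ^ 1" using that by auto
      with Bessel_J_root_iff[OF \<nu>(1), of "sqrt r" "real n + 2 - \<nu> - 2 * \<beta>"] c
      show ?thesis by (simp only:)
    qed
    from smallest_positive_root_cong[OF this]
    show "\<exists>z. smallest_positive_root (\<lambda>r.
              (deriv ^^ n) (Bessel_J \<nu>) (of_real (sqrt r)) \<noteq> 0 \<and>
              of_real (sqrt r) * (deriv ^^ (n + 1)) (Bessel_J \<nu>) (of_real (sqrt r))
                / (deriv ^^ n) (Bessel_J \<nu>) (of_real (sqrt r))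
                + of_real (real n + 2 - \<nu> - 2 * \<beta>) = 0) z
          \<and> starlikeness_radius \<beta> (Bessel_h \<nu> n) = ereal z"
      using starlikeness_radius_pos_exponent[of \<beta> 1 1, OF _ _ _ f] assms by simp
  }
qed

end
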